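(* Let $n\geq 3$ be an arbitrary integer, let $\mathbb{K}$ be a field of characteristic $0$ containing a primitive $n$-th root of unity, and let $I_n\subseteq\mathbb{K}[x,y,z,w]$ be the ideal of the union of the lines in the restricted Fermat arrangement $\mathcal{RF}_3^n(1)$ in $\mathbb{P}^3$. Then the containment $I_n^{(3)}\subseteq I_n^2$ fails, i.e. $I_n^{(3)}\nsubseteq I_n^2$.
   Context: Let $R=\mathbb{K}[x,y,z,w]$ be the homogeneous coordinate ring of $\mathbb{P}^3=\mathbb{P}^3_{\mathbb{K}}$. Fermat arrangement: $\mathcal{F}_3^n$ is the arrangement of the $6n$ planes in $\mathbb{P}^3$ whose union is the zero locus of $F_n(x,y,z,w)=(x^n-y^n)(x^n-z^n)(x^n-w^n)(y^n-z^n)(y^n-w^n)(z^n-w^n)$. Its intersection lattice is the set of all non-empty intersections of planes in $\mathcal{F}_3^n$; for a flat $V$ in this lattice, the multiplicity of $\mathcal{F}_3^n$ along $V$ is the number of planes of $\mathcal{F}_3^n$ containing $V$. Restricted Fermat configuration: $\mathcal{RF}_3^n(1)$ is the union of all lines in the intersection lattice of $\mathcal{F}_3^n$ that have multiplicity at least $3$. $I_n$ is the homogeneous ideal of all polynomials in $R$ vanishing on $\mathcal{RF}_3^n(1)$. Symbolic power: for a homogeneous ideal $I\subseteq R$ and an integer $m\geq 0$, $I^{(m)}=\bigcap_{P\in \mathrm{Ass}(I)}\left(I^mR_P\cap R\right)$, where $\mathrm{Ass}(I)$ is the set of associated primes of $I$ and $I^mR_P\cap R$ is the preimage of $I^mR_P$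 under the localization map $R\to R_P$. *)

theory Defs
  imports
    "HOL-Analysis.Analysis"
    "HOL-Library.Poly_Mapping"
    "HOL-Computational_Algebra.Normalized_Fraction"
    "HOL-Algebra.Ideal_Product"
    "HOL-Algebra.Algebraic_Closure_Type"
begin

section \<open>Symbolic powers of ideals in an integral domain\<close>

text \<open>
  Rings given by type classes are turned into HOL-Algebra rings by
  \<^const>\<open>ring_of_type_algebra\<close>.  In \<^const>\<open>ideals_set\<close> multiplication is the product of ideals
  and the unit is the whole ring, so that the zeroth power of an ideal is the ring itself.
\<close>

definition ideal_power :: "'a::comm_ring_1 set \<Rightarrow> nat \<Rightarrow> 'a set"
  where "ideal_power I m = I [^]\<^bsub>ideals_set ring_of_type_algebra\<^esub> m"

definition associated_primes :: "'a::comm_ring_1 set \<Rightarrow> 'a set set"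
  where "associated_primes I =
    {P. primeideal P ring_of_type_algebra \<and> (\<exists>a. P = {r. r * a \<in> I})}"

text \<open>
  The localization of a domain at a prime \<open>P\<close>, realized inside the fraction field; the
  localization map is then \<^const>\<open>to_fract\<close>.
\<close>

definition localization :: "'a::idom set \<Rightarrow> 'a fract ring"
  where "localization P = ring_of_type_algebra \<lparr>carrier := {Fract a s | a s. s \<notin> P}\<rparr>"

definition extended_ideal :: "'a::idom set \<Rightarrow> 'a set \<Rightarrow> 'a fract set"
  where "extended_ideal P I = Idl\<^bsub>localization P\<^esub> (to_fract ` I)"

definition symbolic_power :: "'a::idom set \<Rightarrow> nat \<Rightarrow> 'a set"
  where "symbolic_power I m =
    (\<Inter>P\<in>associated_primes I. to_fract -` extended_ideal P (ideal_power I m))"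


section \<open>Projective three-space and its coordinate ring\<close>

text \<open>
  The index type \<open>4\<close> has the elements \<open>1, 2, 3, 4\<close>, standing for \<open>x, y, z, w\<close>.
  A polynomial maps exponent vectors to coefficients.
\<close>

type_synonym 'k poly4 = "(4 \<Rightarrow>\<^sub>0 nat) \<Rightarrow>\<^sub>0 'k"

definition Var :: "4 \<Rightarrow> 'k::field poly4"
  where "Var i = Poly_Mapping.single (Poly_Mapping.single i 1) 1"

definition eval :: "'k::field poly4 \<Rightarrow> 'k^4 \<Rightarrow> 'k"
  where "eval f v = (\<Sum>m\<in>Poly_Mapping.keys f.
    Poly_Mapping.lookup f m * (\<Prod>i\<in>UNIV. v $ i ^ Poly_Mapping.lookup m i))"

definition proportional :: "('k::field^4) rel"
  where "proportional = {(u, v). u \<noteq> 0 \<and> (\<exists>c. c \<noteq> 0 \<and> v = c *s u)}"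

text \<open>A point of projective space is the set of all its homogeneous coordinate vectors.\<close>

type_synonym 'k point = "('k^4) set"

definition projectivization :: "('k::field^4) set \<Rightarrow> 'k point set"
  where "projectivization W = (W - {0}) // proportional"

definition proj_space :: "'k::field point set"
  where "proj_space = projectivization UNIV"

definition linear_subspaces :: "nat \<Rightarrow> 'k::field point set set"
  where "linear_subspaces d = {projectivization W | W. vec.subspace W \<and> vec.dim W = d + 1}"

abbreviation lines :: "'k::field point set set"
  where "lines \<equiv> linear_subspaces 1"

abbreviation planes :: "'k::field point set set"
  where "planes \<equiv> linear_subspaces 2"

text \<open>
  An arbitrary polynomial vanishes at a point if it vanishes at all coordinate vectors of the
  point.  Over an infinite field this means that all its homogeneous components vanish there,
  so \<open>vanishing_ideal Z\<close> is the homogeneous ideal of \<open>Z\<close>.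
\<close>

definition vanishes_at :: "'k::field poly4 \<Rightarrow> 'k point \<Rightarrow> bool"
  where "vanishes_at f p \<longleftrightarrow> (\<forall>v\<in>p. eval f v = 0)"

definition zero_locus :: "'k::field poly4 \<Rightarrow> 'k point set"
  where "zero_locus f = {p \<in> proj_space. vanishes_at f p}"

definition vanishing_ideal :: "'k::field point set \<Rightarrow> 'k poly4 set"
  where "vanishing_ideal Z = {f. \<forall>p\<in>Z. vanishes_at f p}"


section \<open>Fermat arrangements\<close>

definition intersection_lattice :: "'k point set set \<Rightarrow> 'k point set set"
  where "intersection_lattice \<A> = {\<Inter>\<B> | \<B>. \<B> \<subseteq> \<A> \<and> \<B> \<noteq> {} \<and> \<Inter>\<B> \<noteq> {}}"

definition multiplicity_along :: "'k point set set \<Rightarrow> 'k point set \<Rightarrow> nat"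
  where "multiplicity_along \<A> V = card {H \<in> \<A>. V \<subseteq> H}"

definition fermat_poly :: "nat \<Rightarrow> 'k::field poly4"
  where "fermat_poly n = (let x = Var 1; y = Var 2; z = Var 3; w = Var 4 in
    (x^n - y^n) * (x^n - z^n) * (x^n - w^n) * (y^n - z^n) * (y^n - w^n) * (z^n - w^n))"

text \<open>
  If the field is infinite and contains a primitive \<open>n\<close>-th root of unity, then the zero locus of
  \<open>fermat_poly n\<close> is the union of \<open>6 * n\<close> planes, and as a plane is not covered by finitely many
  proper linear subspaces, these are exactly the planes contained in the zero locus.
\<close>

definition fermat_arrangement :: "nat \<Rightarrow> 'k::field point set set"
  where "fermat_arrangement n = {H \<in> planes. H \<subseteq> zero_locus (fermat_poly n)}"

definition restricted_fermat :: "nat \<Rightarrow> 'k::field point set"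
  where "restricted_fermat n =
    \<Union>{V \<in> intersection_lattice (fermat_arrangement n).
        V \<in> lines \<and> multiplicity_along (fermat_arrangement n) V \<ge> 3}"

definition restricted_fermat_ideal :: "nat \<Rightarrow> 'k::field poly4 set"
  where "restricted_fermat_ideal n = vanishing_ideal (restricted_fermat n)"

definition primitive_root_of_unity :: "nat \<Rightarrow> 'k::field \<Rightarrow> bool"
  where "primitive_root_of_unity n \<epsilon> \<longleftrightarrow>
    n > 0 \<and> \<epsilon> ^ n = 1 \<and> (\<forall>k. 0 < k \<and> k < n \<longrightarrow> \<epsilon> ^ k \<noteq> 1)"

end

theory Submission
  imports Defs
begin

text \<open>
  The witness is the Fermat polynomial \<open>F\<close>, the product of the linear forms of all planes of the
  arrangement: it lies in the symbolic cube of the ideal \<open>I\<close> of the configuration, but not in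
  the square of \<open>I\<close>.

  Membership in the symbolic cube is local. \<open>I\<close> is the intersection of the ideals of finitely many
  distinct lines, which are pairwise incomparable primes, so the associated primes of \<open>I\<close> are among
  these, and \<open>I\<close> agrees with the ideal of a line after localizing at it. As at least three
  factors of \<open>F\<close> vanish on each line, \<open>F\<close> is in the cube of each of these primes
  (\<open>symbolic_power_InterI\<close>, \<open>fermat_poly_in_symbolic_cube\<close>).

  For the failure of membership in the square consider the plane \<open>w = 0\<close>, with \<open>X = x\<^sup>n\<close>,
  \<open>Y = y\<^sup>n\<close>, \<open>Z = z\<^sup>n\<close>. The following heuristic leads to the functional that is used. On this
  plane the elements of \<open>I\<close> should become combinations of \<open>x\<^sup>n y z (Y - Z)\<close>, \<open>x y\<^sup>n z (Z - X)\<close>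
  and \<open>x y z\<^sup>n (X - Y)\<close>. The square of the first one, times \<open>y z\<close> to the power \<open>n - 2\<close>, is
  \<open>X Y Z\<close> times \<open>X (Y - Z)\<^sup>2\<close>; likewise the other squares give \<open>Y (Z - X)\<^sup>2\<close> and
  \<open>Z (X - Y)\<^sup>2\<close>, while the product of two different ones has too high a degree once all
  exponents have been made divisible by \<open>n\<close>. In each of these three polynomials \<open>X Y\<^sup>2\<close> and
  \<open>X Z\<^sup>2\<close> have the same coefficient. But \<open>F\<close> becomes \<open>X Y Z\<close> times the alternating polynomial
  \<open>(X - Y) (X - Z) (Y - Z)\<close>, where these coefficients are \<open>-1\<close> and \<open>1\<close>. So the difference of the
  coefficients of \<open>x\<^sup>2\<^sup>n y\<^sup>3\<^sup>n z\<^sup>n\<close> and \<open>x\<^sup>2\<^sup>n y\<^sup>n z\<^sup>3\<^sup>n\<close> should separate \<open>F\<close>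
  from the square of \<open>I\<close>.

  The proof does not determine generators of \<open>I\<close>. Vanishing on the lines is a system of linear
  conditions on the coefficients: on coordinate lines single coefficients are zero, and on the
  other lines sums of coefficients over classes of exponents modulo \<open>n\<close> are zero
  (\<open>lookup_eq_0_of_coordinate_line\<close>, \<open>coeff_sum_eq_0\<close>). They imply that the functional vanishes on every
  product of two elements of \<open>I\<close> (\<open>square_coefficients_eq\<close>), while its value at \<open>F\<close> is \<open>-2\<close>
  (\<open>fermat_poly_coefficients\<close>).
\<close>

section \<open>Evaluation of polynomials\<close>

definition monomial_value :: "'k::field^4 \<Rightarrow> (4 \<Rightarrow>\<^sub>0 nat) \<Rightarrow> 'k"
  where "monomial_value v m = (\<Prod>i\<in>UNIV. v $ i ^ Poly_Mapping.lookup m i)"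

lemma monomial_value_add: "monomial_value v (a + b) = monomial_value v a * monomial_value v b"
  by (simp add: monomial_value_def lookup_add power_add prod.distrib)

lemma monomial_value_zero [simp]: "monomial_value v 0 = 1"
  by (simp add: monomial_value_def)

lemma eval_altdef:
  assumes "finite S" "Poly_Mapping.keys f \<subseteq> S"
  shows "eval f v = (\<Sum>m\<in>S. Poly_Mapping.lookup f m * monomial_value v m)"
  unfolding eval_def monomial_value_def
  by (rule sum.mono_neutral_left) (use assms in \<open>auto simp: in_keys_iff\<close>)

lemma eval_zero [simp]: "eval 0 v = 0"
  by (simp add: eval_def)

lemma eval_add [simp]: "eval (f + g) v = eval f v + eval g v"
proof -
  let ?S = "Poly_Mapping.keys f \<union> Poly_Mapping.keys g"
  have "eval h v = (\<Sum>m\<in>?S. Poly_Mapping.lookup h m * monomial_value v m)"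
    if "h \<in> {f, g, f + g}" for h
    using that keys_add[of f g] by (intro eval_altdef) auto
  then show ?thesis
    by (simp add: lookup_add distrib_right sum.distrib)
qed

lemma eval_uminus [simp]: "eval (- f) v = - eval f v"
  using eval_add[of "- f" f v] by (simp add: eq_neg_iff_add_eq_0)

lemma eval_diff [simp]: "eval (f - g) v = eval f v - eval g v"
  using eval_add[of f "- g" v] by simp

lemma eval_sum [simp]: "eval (\<Sum>i\<in>A. h i) v = (\<Sum>i\<in>A. eval (h i) v)"
  by (induction A rule: infinite_finite_induct) auto

lemma eval_single [simp]: "eval (Poly_Mapping.single m c) v = c * monomial_value v m"
  by (subst eval_altdef[where S = "{m}"]) (auto split: if_splits)

text \<open>
  Expanding a polynomial into its monomials reduces multiplicativity of evaluation to the case of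
  two monomials.
\<close>

lemma poly_mapping_eq_sum_single:
  "f = (\<Sum>m\<in>Poly_Mapping.keys f. Poly_Mapping.single m (Poly_Mapping.lookup f m))"
  by (rule poly_mapping_eqI) (simp add: lookup_sum lookup_single when_def in_keys_iff)

lemma eval_mult [simp]: "eval (f * g) v = eval f v * eval g v"
proof -
  let ?s = "\<lambda>h m. Poly_Mapping.single m (Poly_Mapping.lookup h m)"
  have "eval (f * g) v = eval ((\<Sum>a\<in>Poly_Mapping.keys f. ?s f a) * (\<Sum>b\<in>Poly_Mapping.keys g. ?s g b)) v"
    using poly_mapping_eq_sum_single[of f] poly_mapping_eq_sum_single[of g] by simp
  also have "\<dots> = (\<Sum>a\<in>Poly_Mapping.keys f. eval (?s f a) v) * (\<Sum>b\<in>Poly_Mapping.keys g. eval (?s g b) v)"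
    by (simp add: sum_product mult_single monomial_value_add algebra_simps)
  also have "\<dots> = eval f v * eval g v"
    unfolding eval_sum[symmetric] poly_mapping_eq_sum_single[symmetric] ..
  finally show ?thesis .
qed

lemma eval_one [simp]: "eval 1 v = 1"
  using eval_single[of 0 1 v] by (simp add: monomial_value_def)

lemma eval_Var [simp]: "eval (Var i) v = v $ i"
proof -
  have "monomial_value v (Poly_Mapping.single i 1) = (\<Prod>j\<in>UNIV. if j = i then v $ j else 1)"
    unfolding monomial_value_def by (rule prod.cong) (auto simp: lookup_single when_def)
  then show ?thesis
    by (simp add: Var_def)
qed

abbreviation Const :: "'k \<Rightarrow> 'k::field poly4"
  where "Const c \<equiv> Poly_Mapping.single 0 c"


section \<open>Linear subspaces are irreducible\<close>

text \<open>
  Restricting a polynomial function to an affine line of coordinate vectors gives a univariate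
  polynomial, and a nonzero univariate polynomial has only finitely many roots.
\<close>

lemma eval_along_affine_line:
  obtains p where "\<And>c. eval f (v + c *s u) = poly p c"
proof
  fix c
  show "eval f (v + c *s u) = poly (\<Sum>m\<in>Poly_Mapping.keys f.
      [:Poly_Mapping.lookup f m:] * (\<Prod>i\<in>UNIV. [:v $ i, u $ i:] ^ Poly_Mapping.lookup m i)) c"
    by (simp add: eval_def poly_sum poly_prod)
qed

definition cone_ideal :: "('k::field^4) set \<Rightarrow> 'k poly4 set"
  where "cone_ideal W = {f. \<forall>v\<in>W. eval f v = 0}"

lemma ideal_type_algebraI:
  fixes I :: "'a::comm_ring_1 set"
  assumes "0 \<in> I" "\<And>a b. a \<in> I \<Longrightarrow> b \<in> I \<Longrightarrow> a + b \<in> I" "\<And>a r. a \<in> I \<Longrightarrow> r * a \<in> I"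
  shows "ideal I ring_of_type_algebra"
proof (rule idealI)
  show "ring (ring_of_type_algebra :: 'a ring)"
    by (rule ring_from_type_algebra)
  interpret R: ring "ring_of_type_algebra :: 'a ring"
    by (rule ring_from_type_algebra)
  show "subgroup I (add_monoid ring_of_type_algebra)"
  proof (rule R.add.subgroupI)
    fix a assume "a \<in> I"
    then have "- a \<in> I"
      using assms(3)[of a "- 1"] by simp
    moreover have "\<ominus>\<^bsub>ring_of_type_algebra\<^esub> a = - a"
      by (rule R.minus_equality) (auto simp: ring_of_type_algebra_def)
    ultimately show "\<ominus>\<^bsub>ring_of_type_algebra\<^esub> a \<in> I"
      by simp
  qed (use assms in \<open>auto simp: ring_of_type_algebra_def\<close>)
qed (use assms in \<open>auto simp: ring_of_type_algebra_def mult.commute\<close>)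

lemma primeideal_type_algebraI:
  fixes I :: "'a::comm_ring_1 set"
  assumes "ideal I ring_of_type_algebra" "1 \<notin> I" "\<And>a b. a * b \<in> I \<Longrightarrow> a \<in> I \<or> b \<in> I"
  shows "primeideal I ring_of_type_algebra"
proof (rule primeidealI)
  show "carrier ring_of_type_algebra \<noteq> I"
    using assms(2) by (auto simp: ring_of_type_algebra_def)
qed (use assms in \<open>auto simp: ring_of_type_algebra_def cring_from_type_algebra[unfolded ring_of_type_algebra_def]\<close>)

text \<open>
  If \<open>f\<close> does not vanish at \<open>u\<close> and \<open>g\<close> does not vanish at \<open>v\<close>, then on the affine line through
  \<open>u\<close> and \<open>v\<close> both are nonzero univariate polynomials. Their product is nonzero as well, so over an
  infinite field \<open>f * g\<close> does not vanish identically on that line.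
\<close>

lemma primeideal_cone_ideal:
  fixes W :: "('k::field_char_0^4) set"
  assumes "vec.subspace W"
  shows "primeideal (cone_ideal W) ring_of_type_algebra"
proof (rule primeideal_type_algebraI)
  show "ideal (cone_ideal W) ring_of_type_algebra"
    by (rule ideal_type_algebraI) (auto simp: cone_ideal_def)
  have "0 \<in> W"
    by (rule vec.subspace_0[OF assms])
  then show "1 \<notin> cone_ideal W"
    by (auto simp: cone_ideal_def)
next
  fix f g :: "'k poly4"
  assume fg: "f * g \<in> cone_ideal W"
  show "f \<in> cone_ideal W \<or> g \<in> cone_ideal W"
  proof (rule ccontr)
    assume "\<not> ?thesis"
    then obtain u v where uv: "u \<in> W" "v \<in> W" "eval f u \<noteq> 0" "eval g v \<noteq> 0"
      by (auto simp: cone_ideal_def)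
    obtain p where p: "\<And>c. eval f (u + c *s (v - u)) = poly p c"
      using eval_along_affine_line[of f u "v - u"] by metis
    obtain q where q: "\<And>c. eval g (u + c *s (v - u)) = poly q c"
      using eval_along_affine_line[of g u "v - u"] by metis
    have "p \<noteq> 0" "q \<noteq> 0"
      using p[of 0] q[of 1] uv by auto
    moreover have "poly (p * q) c = 0" for c
    proof -
      have "u + c *s (v - u) \<in> W"
        using assms uv by (intro vec.subspace_add vec.subspace_scale vec.subspace_diff)
      then show ?thesis
        using fg by (auto simp: cone_ideal_def simp flip: p q)
    qed
    ultimately show False
      using poly_all_0_iff_0[of "p * q"] by simp
  qed
qed


section \<open>Symbolic powers of finite intersections of primes\<close>

lemma ideal_power_0 [simp]: "ideal_power I 0 = UNIV"
  by (simp add: ideal_power_def nat_pow_def ideals_set_def ring_of_type_algebra_def)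

lemma ideal_power_Suc:
  "ideal_power I (Suc m) = ideal_prod ring_of_type_algebra (ideal_power I m) I"
  by (simp add: ideal_power_def nat_pow_def ideals_set_def)

lemma ideal_power_SucI:
  assumes "a \<in> ideal_power I m" "b \<in> I"
  shows "a * b \<in> ideal_power I (Suc m)"
  using ideal_prod.prod[OF assms, of ring_of_type_algebra]
  by (simp add: ideal_power_Suc ring_of_type_algebra_def)

lemma ideal_power_induct [consumes 1, case_names mult add]:
  assumes "x \<in> ideal_power I (Suc m)"
    and "\<And>a b. a \<in> ideal_power I m \<Longrightarrow> b \<in> I \<Longrightarrow> Q (a * b)"
    and "\<And>a b. Q a \<Longrightarrow> Q b \<Longrightarrow> Q (a + b)"
  shows "Q x"
  using assms(1) unfolding ideal_power_Suc
proof (induction rule: ideal_prod.induct)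
  case (prod i j)
  then show ?case using assms(2) by (simp add: ring_of_type_algebra_def)
next
  case (sum a b)
  then show ?case using assms(3) by (simp add: ring_of_type_algebra_def)
qed

lemma ideal_power_add:
  fixes I :: "'a::comm_ring_1 set"
  assumes "x \<in> ideal_power I m" "y \<in> ideal_power I m"
  shows "x + y \<in> ideal_power I m"
proof (cases m)
  case (Suc k)
  then show ?thesis
    using assms ideal_prod.sum[of x ring_of_type_algebra "ideal_power I k" I y]
    by (simp add: ideal_power_Suc ring_of_type_algebra_def)
qed simp

text \<open>
  Multiplication by \<open>u\<close> moves each of the \<open>m\<close> factors of a product from \<open>P\<close> into \<open>I\<close>; one power of
  \<open>u\<close> is spent per factor.
\<close>

lemma power_mult_ideal_power:
  fixes P :: "'a::comm_ring_1 set"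
  assumes "\<And>p. p \<in> P \<Longrightarrow> u * p \<in> I" "x \<in> ideal_power P m"
  shows "u ^ m * x \<in> ideal_power I m"
  using assms(2)
proof (induction m arbitrary: x)
  case (Suc m)
  from Suc.prems show ?case
  proof (induction rule: ideal_power_induct)
    case (mult a b)
    have "(u ^ m * a) * (u * b) \<in> ideal_power I (Suc m)"
      by (intro ideal_power_SucI Suc.IH assms(1) mult)
    then show ?case
      by (simp add: algebra_simps)
  next
    case (add a b)
    then show ?case
      by (simp add: distrib_left ideal_power_add)
  qed
qed simp

lemma primeideal_type_algebraD:
  fixes P :: "'a::comm_ring_1 set"
  assumes "primeideal P ring_of_type_algebra"
  shows "a * b \<in> P \<Longrightarrow> a \<in> P \<or> b \<in> P" and "1 \<notin> P" and "a \<in> P \<Longrightarrow> r * a \<in> P" and "0 \<in> P"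
proof -
  interpret primeideal P "ring_of_type_algebra :: 'a ring" by (rule assms)
  show "a * b \<in> P \<Longrightarrow> a \<in> P \<or> b \<in> P"
    using I_prime[of a b] by (auto simp: ring_of_type_algebra_def)
  show "1 \<notin> P"
    using I_notcarr one_imp_carrier by (auto simp: ring_of_type_algebra_def)
  show "a \<in> P \<Longrightarrow> r * a \<in> P"
    using I_l_closed[of a r] by (auto simp: ring_of_type_algebra_def)
  show "0 \<in> P"
    using additive_subgroup.zero_closed[OF is_additive_subgroup]
    by (simp add: ring_of_type_algebra_def)
qed

lemma primeideal_prod:
  fixes P :: "'a::comm_ring_1 set"
  assumes "primeideal P ring_of_type_algebra" "finite A" "(\<Prod>i\<in>A. h i) \<in> P"
  shows "\<exists>i\<in>A. h i \<in> P"
  using assms(2,3) primeideal_type_algebraD(1,2)[OF assms(1)]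
  by (induction A rule: finite_induct) auto

text \<open>
  If \<open>P\<close> is the set of multipliers of \<open>a\<close> into the intersection, only the primes not containing
  \<open>a\<close> matter. \<open>P\<close> is contained in each of these by primality, and it contains one of them: otherwise
  choose an element outside \<open>P\<close> from each; their product multiplies \<open>a\<close> into the intersection, so the
  prime \<open>P\<close> would contain one of the chosen elements.
\<close>

lemma associated_prime_of_Inter:
  fixes \<Q> :: "'a::comm_ring_1 set set"
  assumes "finite \<Q>" "\<And>Q. Q \<in> \<Q> \<Longrightarrow> primeideal Q ring_of_type_algebra"
    and "P \<in> associated_primes (\<Inter>\<Q>)"
  shows "P \<in> \<Q>"
proof -
  obtain a where P: "P = {r. r * a \<in> \<Inter>\<Q>}" and prime: "primeideal P ring_of_type_algebra"
    using assms(3) by (auto simp: associated_primes_def)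
  define \<Q>' where "\<Q>' = {Q \<in> \<Q>. a \<notin> Q}"
  have sub: "P \<subseteq> Q" if "Q \<in> \<Q>'" for Q
    using that primeideal_type_algebraD(1)[OF assms(2)] by (auto simp: P \<Q>'_def)
  have "\<exists>Q\<in>\<Q>'. Q \<subseteq> P"
  proof (rule ccontr)
    assume "\<not> ?thesis"
    then have "\<forall>Q\<in>\<Q>'. \<exists>h. h \<in> Q \<and> h \<notin> P"
      by blast
    then obtain h where h: "\<And>Q. Q \<in> \<Q>' \<Longrightarrow> h Q \<in> Q \<and> h Q \<notin> P"
      by metis
    have fin: "finite \<Q>'"
      using assms(1) by (simp add: \<Q>'_def)
    have "(\<Prod>Q\<in>\<Q>'. h Q) * a \<in> Q" if "Q \<in> \<Q>" for Q
    proof (cases "Q \<in> \<Q>'")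
      case True
      then have "(\<Prod>Q\<in>\<Q>'. h Q) * a = ((\<Prod>Q\<in>\<Q>' - {Q}. h Q) * a) * h Q"
        using fin by (simp add: prod.remove[of _ Q] algebra_simps)
      then show ?thesis
        using h[OF True] primeideal_type_algebraD(3)[OF assms(2)[OF that], of "h Q"] by simp
    next
      case False
      then show ?thesis
        using that primeideal_type_algebraD(3)[OF assms(2)[OF that]] by (simp add: \<Q>'_def)
    qed
    then have "(\<Prod>Q\<in>\<Q>'. h Q) \<in> P"
      by (simp add: P)
    then show False
      using primeideal_prod[OF prime fin] h by blast
  qed
  then obtain Q where "Q \<in> \<Q>'" "Q \<subseteq> P"
    by blast
  with sub[of Q] show ?thesis
    by (simp add: \<Q>'_def)
qed

text \<open>
  Membership in the extension to the localization at \<open>P\<close> only requires clearing a denominator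
  outside \<open>P\<close>.
\<close>

lemma symbolic_powerI:
  fixes I :: "'a::idom set"
  assumes "\<And>P. P \<in> associated_primes I \<Longrightarrow> \<exists>s. s \<notin> P \<and> s * f \<in> ideal_power I m"
  shows "f \<in> symbolic_power I m"
  unfolding symbolic_power_def
proof (clarsimp simp: extended_ideal_def genideal_def)
  fix P J
  assume P: "P \<in> associated_primes I" and J: "ideal J (localization P)"
    and sub: "to_fract ` ideal_power I m \<subseteq> J"
  obtain s where s: "s \<notin> P" "s * f \<in> ideal_power I m"
    using assms[OF P] by blast
  interpret primeideal P "ring_of_type_algebra :: 'a ring"
    using P by (simp add: associated_primes_def)
  have "s \<noteq> 0"
    using s(1) primeideal_type_algebraD(4)[of P] primeideal_axioms by auto
  have "Fract 1 s \<otimes>\<^bsub>localization P\<^esub> to_fract (s * f) \<in> J"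
    by (rule ideal.I_l_closed[OF J]) (use s sub in \<open>auto simp: localization_def\<close>)
  moreover have "Fract 1 s \<otimes>\<^bsub>localization P\<^esub> to_fract (s * f) = to_fract f"
    using \<open>s \<noteq> 0\<close>
    by (simp add: localization_def ring_of_type_algebra_def to_fract_def eq_fract)
  ultimately show "to_fract f \<in> J"
    by simp
qed

text \<open>
  An irredundant finite intersection of primes has no embedded components, and it agrees with the prime
  \<open>P\<close> after localizing at \<open>P\<close>. Concretely, pick \<open>u\<close> in all the other primes but not in \<open>P\<close>. Then
  \<open>u\<close> maps \<open>P\<close> into the intersection, and hence \<open>u ^ m\<close> maps the \<open>m\<close>-th power of \<open>P\<close> into the
  \<open>m\<close>-th power of the intersection.
\<close>

lemma symbolic_power_InterI:
  fixes \<Q> :: "'a::idom set set"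
  assumes "finite \<Q>" and prime: "\<And>Q. Q \<in> \<Q> \<Longrightarrow> primeideal Q ring_of_type_algebra"
    and incomparable: "\<And>P Q. P \<in> \<Q> \<Longrightarrow> Q \<in> \<Q> \<Longrightarrow> P \<subseteq> Q \<Longrightarrow> P = Q"
    and f: "\<And>Q. Q \<in> \<Q> \<Longrightarrow> f \<in> ideal_power Q m"
  shows "f \<in> symbolic_power (\<Inter>\<Q>) m"
proof (rule symbolic_powerI)
  fix P assume "P \<in> associated_primes (\<Inter>\<Q>)"
  then have P: "P \<in> \<Q>"
    using associated_prime_of_Inter[OF assms(1) prime] by blast
  have "\<forall>Q\<in>\<Q> - {P}. \<exists>h. h \<in> Q \<and> h \<notin> P"
    using incomparable P by blast
  then obtain h where h: "\<And>Q. Q \<in> \<Q> - {P} \<Longrightarrow> h Q \<in> Q \<and> h Q \<notin> P"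
    by metis
  define u where "u = (\<Prod>Q\<in>\<Q> - {P}. h Q)"
  have "u \<notin> P"
    using primeideal_prod[OF prime[OF P], of "\<Q> - {P}" h] h assms(1) by (auto simp: u_def)
  then have "u ^ m \<notin> P"
    using primeideal_type_algebraD(1,2)[OF prime[OF P]] by (induction m) auto
  moreover have "u * p \<in> \<Inter>\<Q>" if "p \<in> P" for p
  proof
    fix Q assume Q: "Q \<in> \<Q>"
    show "u * p \<in> Q"
    proof (cases "Q = P")
      case True
      then show ?thesis
        using that primeideal_type_algebraD(3)[OF prime[OF P]] by simp
    next
      case False
      then have "u = h Q * (\<Prod>Q\<in>\<Q> - {P} - {Q}. h Q)"
        unfolding u_def using assms(1) Q by (intro prod.remove) auto
      then have "u * p = ((\<Prod>Q\<in>\<Q> - {P} - {Q}. h Q) * p) * h Q"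
        by (simp only: ac_simps)
      also have "\<dots> \<in> Q"
        using h[of Q] Q False by (intro primeideal_type_algebraD(3)[OF prime[OF Q]]) auto
      finally show ?thesis .
    qed
  qed
  then have "u ^ m * f \<in> ideal_power (\<Inter>\<Q>) m"
    using f[OF P] by (rule power_mult_ideal_power)
  ultimately show "\<exists>s. s \<notin> P \<and> s * f \<in> ideal_power (\<Inter>\<Q>) m"
    by blast
qed


section \<open>Roots of unity\<close>

definition roots_of_unity :: "nat \<Rightarrow> 'k::field set"
  where "roots_of_unity n = {a. a ^ n = 1}"

lemma roots_of_unity_finite_card_le:
  assumes "n > 0"
  shows "finite (roots_of_unity n :: 'k::field set)" "card (roots_of_unity n :: 'k set) \<le> n"
proof -
  define p :: "'k poly" where "p = Polynomial.monom 1 n - 1"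
  have "Polynomial.coeff p n = 1"
    using assms by (simp add: p_def)
  then have "p \<noteq> 0"
    by auto
  moreover have "Polynomial.degree p \<le> n"
    unfolding p_def by (rule degree_diff_le) (auto simp: degree_monom_le)
  moreover have "roots_of_unity n = {x. poly p x = 0}"
    by (auto simp: roots_of_unity_def p_def poly_monom)
  ultimately show "finite (roots_of_unity n :: 'k set)" "card (roots_of_unity n :: 'k set) \<le> n"
    using poly_roots_finite[of p] card_poly_roots_bound[of p] by auto
qed

lemma inj_on_power_primitive_root:
  assumes "primitive_root_of_unity n \<epsilon>"
  shows "inj_on (\<lambda>k. \<epsilon> ^ k) {..<n}"
proof (rule linorder_inj_onI')
  fix i j assume ij: "i \<in> {..<n}" "j \<in> {..<n}" "i < j"
  have "\<epsilon> \<noteq> 0"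
    using assms by (auto simp: primitive_root_of_unity_def power_0_left)
  moreover have "\<epsilon> ^ (j - i) \<noteq> 1"
    using assms ij by (auto simp: primitive_root_of_unity_def)
  ultimately show "\<epsilon> ^ i \<noteq> \<epsilon> ^ j"
    using ij by (simp add: power_diff)
qed

lemma card_roots_of_unity:
  assumes "primitive_root_of_unity n (\<epsilon> :: 'k::field)"
  shows "card (roots_of_unity n :: 'k set) = n"
proof (rule antisym)
  have n: "n > 0" "\<epsilon> ^ n = 1"
    using assms by (auto simp: primitive_root_of_unity_def)
  show "card (roots_of_unity n :: 'k set) \<le> n"
    by (rule roots_of_unity_finite_card_le(2)[OF n(1)])
  have "(\<epsilon> ^ k) ^ n = 1" for k
  proof -
    have "(\<epsilon> ^ k) ^ n = (\<epsilon> ^ n) ^ k"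
      by (simp only: power_mult[symmetric] mult.commute)
    then show ?thesis
      by (simp only: n(2) power_one)
  qed
  then have "(\<lambda>k. \<epsilon> ^ k) ` {..<n} \<subseteq> roots_of_unity n"
    by (auto simp: roots_of_unity_def)
  then show "n \<le> card (roots_of_unity n :: 'k set)"
    using card_mono[OF roots_of_unity_finite_card_le(1)[OF n(1)]] card_image[OF inj_on_power_primitive_root[OF assms]]
    by (metis card_lessThan)
qed

text \<open>
  Multiplication by a primitive root permutes the roots of unity and multiplies the sum of their
  \<open>d\<close>-th powers by \<open>\<epsilon> ^ d\<close>, which differs from 1 unless \<open>n\<close> divides \<open>d\<close>.
\<close>

lemma sum_roots_of_unity_power:
  assumes "primitive_root_of_unity n (\<epsilon> :: 'k::field)"
  shows "(\<Sum>a\<in>roots_of_unity n. a ^ d :: 'k) = (if n dvd d then of_nat n else 0)"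
proof (cases "n dvd d")
  case True
  then have "(\<Sum>a\<in>roots_of_unity n. a ^ d :: 'k) = (\<Sum>a\<in>(roots_of_unity n :: 'k set). 1)"
    by (intro sum.cong) (auto simp: roots_of_unity_def power_mult)
  then show ?thesis
    using True card_roots_of_unity[OF assms] by simp
next
  case False
  have n: "n > 0" "\<epsilon> ^ n = 1" and prim: "\<And>k. 0 < k \<Longrightarrow> k < n \<Longrightarrow> \<epsilon> ^ k \<noteq> 1"
    using assms by (auto simp: primitive_root_of_unity_def)
  have "\<epsilon> ^ d = \<epsilon> ^ (n * (d div n) + d mod n)"
    by simp
  also have "\<dots> = \<epsilon> ^ (d mod n)"
    unfolding power_add power_mult using n by simp
  finally have "\<epsilon> ^ d \<noteq> 1"
    using False n prim[of "d mod n"] by (auto simp: mod_greater_zero_iff_not_dvd)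
  have "\<epsilon> \<noteq> 0"
    using n by (auto simp: power_0_left)
  have "(\<Sum>a\<in>roots_of_unity n. a ^ d) = (\<Sum>a\<in>roots_of_unity n. (\<epsilon> * a) ^ d)"
    by (rule sum.reindex_bij_witness[of _ "\<lambda>a. \<epsilon> * a" "\<lambda>a. a / \<epsilon>"])
      (use n \<open>\<epsilon> \<noteq> 0\<close> in \<open>auto simp: roots_of_unity_def power_mult_distrib power_divide\<close>)
  also have "\<dots> = \<epsilon> ^ d * (\<Sum>a\<in>roots_of_unity n. a ^ d)"
    by (simp add: power_mult_distrib sum_distrib_left)
  finally show ?thesis
    using False \<open>\<epsilon> ^ d \<noteq> 1\<close> by simp
qed

text \<open>
  For nonzero \<open>y\<close> both sides are values at \<open>x\<close> of monic polynomials of degree \<open>n\<close> in one variable over the domain,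
  and these agree at the \<open>n\<close> distinct points \<open>a * y\<close>. This version applies with \<open>x\<close> and \<open>y\<close>
  themselves polynomials.
\<close>

lemma power_diff_power_factor:
  fixes x y :: "'a::idom"
  assumes "finite A" "card A = n" "\<And>a. a \<in> A \<Longrightarrow> a ^ n = 1" "n > 0"
  shows "x ^ n - y ^ n = (\<Prod>a\<in>A. x - a * y)"
proof (cases "y = 0")
  case True
  then show ?thesis using assms by (simp add: power_0_left)
next
  case False
  define p where "p = Polynomial.monom 1 n - [:y ^ n:]"
  define q where "q = (\<Prod>a\<in>A. [:- (a * y), 1:])"
  have inj: "inj_on (\<lambda>a. a * y) A"
    using False by (auto intro: inj_onI)
  have deg_q: "Polynomial.degree q = n"
    unfolding q_def using assms by (subst degree_prod_eq_sum_degree) auto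
  have "p = q"
  proof (rule poly_eqI_degree_lead_coeff)
    have "Polynomial.lead_coeff q = 1"
      by (simp add: q_def lead_coeff_prod)
    then show "Polynomial.coeff p n = Polynomial.coeff q n"
      using deg_q \<open>n > 0\<close> by (simp add: p_def coeff_pCons split: nat.splits)
    show "n \<le> card ((\<lambda>a. a * y) ` A)"
      using card_image[OF inj] assms(2) by simp
    show "Polynomial.degree p \<le> n"
      unfolding p_def by (rule degree_diff_le) (auto simp: degree_monom_le)
    show "Polynomial.degree q \<le> n"
      by (simp add: deg_q)
    fix z assume "z \<in> (\<lambda>a. a * y) ` A"
    then show "poly p z = poly q z"
      using assms by (auto simp: p_def q_def poly_monom poly_prod power_mult_distrib)
  qed
  then have "poly p x = poly q x"
    by simp
  then show ?thesis
    by (simp add: p_def q_def poly_monom poly_prod)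
qed

section \<open>Coefficients of polynomials vanishing on lines\<close>

text \<open>
  The following two lemmas turn the vanishing of a polynomial on a parametrized family of points
  into linear relations between its coefficients. A parameter that ranges over the field
  isolates the terms in which its exponent has a prescribed value; a parameter that ranges over the
  \<open>n\<close>-th roots of unity isolates a residue class of exponents modulo \<open>n\<close>, by a discrete Fourier
  transform.
\<close>

lemma power_sum_extract_degree:
  fixes c :: "'m \<Rightarrow> 'k::field_char_0"
  assumes "\<And>t. (\<Sum>m\<in>M. c m * t ^ A m) = 0" "finite M"
  shows "(\<Sum>m\<in>{m \<in> M. A m = \<alpha>}. c m) = 0"
proof -
  define p where "p = (\<Sum>m\<in>M. Polynomial.monom (c m) (A m))"
  have "poly p t = 0" for t
    using assms(1) by (simp add: p_def poly_sum poly_monom)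
  then have "p = 0"
    using poly_all_0_iff_0 by blast
  then have "0 = Polynomial.coeff p \<alpha>"
    by simp
  also have "\<dots> = (\<Sum>m\<in>M. if A m = \<alpha> then c m else 0)"
    by (simp add: p_def Polynomial.coeff_sum)
  also have "\<dots> = (\<Sum>m\<in>{m \<in> M. A m = \<alpha>}. c m)"
    using assms(2) by (simp add: sum.inter_filter)
  finally show ?thesis ..
qed

lemma power_sum_extract_residue:
  fixes c :: "'m \<Rightarrow> 'k::field_char_0"
  assumes prim: "primitive_root_of_unity n (\<epsilon> :: 'k)"
    and "\<And>a. a \<in> roots_of_unity n \<Longrightarrow> (\<Sum>m\<in>M. c m * a ^ A m) = 0" "finite M"
  shows "(\<Sum>m\<in>{m \<in> M. A m mod n = \<alpha> mod n}. c m) = 0"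
proof -
  have n: "n > 0"
    using prim by (simp add: primitive_root_of_unity_def)
  \<comment> \<open>Averaging against \<open>a ^ \<beta>\<close> is averaging against \<open>a\<close> to the power \<open>- \<alpha>\<close>.\<close>
  define \<beta> where "\<beta> = n - \<alpha> mod n"
  have dvd: "n dvd A m + \<beta> \<longleftrightarrow> A m mod n = \<alpha> mod n" for m
  proof -
    have "n dvd A m + \<beta> \<longleftrightarrow> int n dvd int (A m) + (int n - int (\<alpha> mod n))"
      using mod_less_divisor[OF n, of \<alpha>] by (simp add: \<beta>_def of_nat_diff add_diff_eq flip: int_dvd_int_iff)
    also have "\<dots> \<longleftrightarrow> int n dvd (int (A m) - int (\<alpha> mod n)) + int n"
      by (simp add: algebra_simps)
    also have "\<dots> \<longleftrightarrow> int (A m) mod int n = int (\<alpha> mod n) mod int n"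
      by (simp add: mod_eq_dvd_iff)
    also have "\<dots> \<longleftrightarrow> A m mod n = \<alpha> mod n"
      by (simp flip: of_nat_mod)
    finally show ?thesis .
  qed
  have "0 = (\<Sum>a\<in>roots_of_unity n. a ^ \<beta> * (\<Sum>m\<in>M. c m * a ^ A m))"
    using assms(2) by simp
  also have "\<dots> = (\<Sum>m\<in>M. c m * (\<Sum>a\<in>roots_of_unity n. a ^ (A m + \<beta>)))"
    by (simp add: sum_distrib_left power_add algebra_simps) (rule sum.swap)
  also have "\<dots> = (\<Sum>m\<in>M. if A m mod n = \<alpha> mod n then of_nat n * c m else 0)"
    by (intro sum.cong) (auto simp: sum_roots_of_unity_power[OF prim] dvd)
  also have "\<dots> = of_nat n * (\<Sum>m\<in>{m \<in> M. A m mod n = \<alpha> mod n}. c m)"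
    using assms(3) by (simp add: sum.inter_filter sum_distrib_left if_distrib cong: if_cong)
  finally show ?thesis
    using n by simp
qed

text \<open>
  Both kinds of lines of multiplicity at least 3 have this form: for \<open>a\<close> and \<open>b\<close> roots of unity the
  line lies on three planes of the arrangement, and for \<open>a = b = 0\<close> it is a coordinate line, which
  lies on \<open>n\<close> of them.
\<close>

definition codim2 :: "4 \<Rightarrow> 4 \<Rightarrow> 4 \<Rightarrow> 'k::field \<Rightarrow> 'k \<Rightarrow> ('k^4) set"
  where "codim2 i j k a b = {v. v $ i = a * v $ k \<and> v $ j = b * v $ k}"

lemma UNIV_4_distinct:
  assumes "distinct [i, j, k, l]"
  shows "UNIV = {i, j, k, l :: 4}"
proof -
  have "card {i, j, k, l} = CARD(4)"
    using assms by simp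
  then show ?thesis
    by (metis card_subset_eq finite subset_UNIV)
qed

text \<open>
  The points with coordinates \<open>a * t\<close>, \<open>b * t\<close>, \<open>t\<close>, \<open>s\<close> at the positions \<open>i\<close>, \<open>j\<close>, \<open>k\<close>, \<open>l\<close> lie on
  the lines in the hypothesis. The two extraction lemmas are applied to the four parameters \<open>a\<close>, \<open>b\<close>, \<open>t\<close>,
  \<open>s\<close> in turn.
\<close>

lemma coeff_sum_eq_0:
  fixes f :: "'k::field_char_0 poly4"
  assumes prim: "primitive_root_of_unity n (\<epsilon> :: 'k)" and dist: "distinct [i, j, k, l]"
    and van: "\<And>a b. a \<in> roots_of_unity n \<Longrightarrow> b \<in> roots_of_unity n \<Longrightarrow> f \<in> cone_ideal (codim2 i j k a b)"
  shows "(\<Sum>m\<in>{m \<in> Poly_Mapping.keys f. Poly_Mapping.lookup m i mod n = \<alpha> mod n \<and>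
      Poly_Mapping.lookup m j mod n = \<beta> mod n \<and>
      Poly_Mapping.lookup m i + Poly_Mapping.lookup m j + Poly_Mapping.lookup m k = \<gamma> \<and>
      Poly_Mapping.lookup m l = \<delta>}. Poly_Mapping.lookup f m) = 0"
proof -
  let ?e = "Poly_Mapping.lookup"
  let ?M0 = "Poly_Mapping.keys f"
  let ?M1 = "{m \<in> ?M0. ?e m i mod n = \<alpha> mod n}"
  let ?M2 = "{m \<in> ?M1. ?e m j mod n = \<beta> mod n}"
  let ?M3 = "{m \<in> ?M2. ?e m i + ?e m j + ?e m k = \<gamma>}"
  let ?M4 = "{m \<in> ?M3. ?e m l = \<delta>}"
  have 0: "(\<Sum>m\<in>?M0. (?e f m * s ^ ?e m l * t ^ (?e m i + ?e m j + ?e m k) * b ^ ?e m j) * a ^ ?e m i) = 0"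
    if ab: "a \<in> roots_of_unity n" "b \<in> roots_of_unity n" for s t a b
  proof -
    define v :: "'k^4" where "v = (\<chi> x. if x = i then a * t else if x = j then b * t else if x = k then t else s)"
    have "v \<in> codim2 i j k a b"
      using dist by (auto simp: codim2_def v_def)
    then have "eval f v = 0"
      using van[OF ab] by (auto simp: cone_ideal_def)
    moreover have "monomial_value v m = s ^ ?e m l * t ^ (?e m i + ?e m j + ?e m k) * b ^ ?e m j * a ^ ?e m i" for m
      using dist unfolding monomial_value_def UNIV_4_distinct[OF dist]
      by (auto simp: v_def power_add power_mult_distrib)
    ultimately show ?thesis
      by (simp add: eval_altdef[of ?M0] mult.assoc)
  qed
  have 1: "(\<Sum>m\<in>?M1. (?e f m * s ^ ?e m l * t ^ (?e m i + ?e m j + ?e m k)) * b ^ ?e m j) = 0"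
    if "b \<in> roots_of_unity n" for s t b
    by (rule power_sum_extract_residue[OF prim 0]) (use that in auto)
  have 2: "(\<Sum>m\<in>?M2. (?e f m * s ^ ?e m l) * t ^ (?e m i + ?e m j + ?e m k)) = 0" for s t
    by (rule power_sum_extract_residue[OF prim 1]) auto
  have 3: "(\<Sum>m\<in>?M3. ?e f m * s ^ ?e m l) = 0" for s
    by (rule power_sum_extract_degree[OF 2]) auto
  have "(\<Sum>m\<in>?M4. ?e f m) = 0"
    by (rule power_sum_extract_degree[OF 3]) auto
  then show ?thesis
    by (simp add: conj_ac)
qed

text \<open>
  Restricted to a coordinate line, a polynomial keeps exactly its monomials in the two remaining
  variables, and these are linearly independent functions.
\<close>

lemma lookup_eq_0_of_coordinate_line:
  fixes f :: "'k::field_char_0 poly4"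
  assumes dist: "distinct [i, j, k, l]" and van: "f \<in> cone_ideal (codim2 i j k 0 0)"
    and m: "Poly_Mapping.lookup m i = 0" "Poly_Mapping.lookup m j = 0"
  shows "Poly_Mapping.lookup f m = 0"
proof -
  let ?e = "Poly_Mapping.lookup"
  let ?M0 = "{m \<in> Poly_Mapping.keys f. ?e m i = 0 \<and> ?e m j = 0}"
  have 0: "(\<Sum>m\<in>?M0. (?e f m * s ^ ?e m l) * t ^ ?e m k) = 0" for s t
  proof -
    define v :: "'k^4" where "v = (\<chi> x. if x = k then t else if x = l then s else 0)"
    have "v \<in> codim2 i j k 0 0"
      using dist by (auto simp: codim2_def v_def)
    then have "0 = eval f v"
      using van by (auto simp: cone_ideal_def)
    also have "\<dots> = (\<Sum>m\<in>Poly_Mapping.keys f. ?e f m * monomial_value v m)"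
      by (rule eval_altdef) auto
    also have "\<dots> = (\<Sum>m\<in>Poly_Mapping.keys f. if ?e m i = 0 \<and> ?e m j = 0 then (?e f m * s ^ ?e m l) * t ^ ?e m k else 0)"
      using dist unfolding monomial_value_def UNIV_4_distinct[OF dist]
      by (intro sum.cong) (auto simp: v_def power_0_left)
    also have "\<dots> = (\<Sum>m\<in>?M0. (?e f m * s ^ ?e m l) * t ^ ?e m k)"
      by (simp add: sum.inter_filter)
    finally show ?thesis ..
  qed
  have 1: "(\<Sum>m'\<in>{m' \<in> ?M0. ?e m' k = ?e m k}. ?e f m' * s ^ ?e m' l) = 0" for s
    by (rule power_sum_extract_degree[OF 0]) auto
  have "(\<Sum>m'\<in>{m' \<in> {m' \<in> ?M0. ?e m' k = ?e m k}. ?e m' l = ?e m l}. ?e f m') = 0"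
    by (rule power_sum_extract_degree[OF 1]) auto
  moreover have "m' = m" if "?e m' i = 0" "?e m' j = 0" "?e m' k = ?e m k" "?e m' l = ?e m l" for m'
  proof (rule poly_mapping_eqI)
    fix x
    have "x \<in> {i, j, k, l}"
      using UNIV_4_distinct[OF dist] by blast
    then show "?e m' x = ?e m x"
      using that m by auto
  qed
  then have "{m' \<in> {m' \<in> ?M0. ?e m' k = ?e m k}. ?e m' l = ?e m l} = {m} \<inter> Poly_Mapping.keys f"
    using m by auto
  ultimately show ?thesis
    by (cases "m \<in> Poly_Mapping.keys f") (auto simp: in_keys_iff)
qed


section \<open>A linear functional that vanishes on the square\<close>

text \<open>
  These conditions on a polynomial follow from membership in the ideal of the restricted Fermat
  configuration, and the linear relations between coefficients are derived from them alone.
\<close>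

definition line_conditions :: "nat \<Rightarrow> 'k::field poly4 set"
  where "line_conditions n = {f. \<forall>i j k. distinct [i, j, k] \<longrightarrow>
    f \<in> cone_ideal (codim2 i j k 0 0) \<and>
    (\<forall>a\<in>roots_of_unity n. \<forall>b\<in>roots_of_unity n. f \<in> cone_ideal (codim2 i j k a b))}"

lemma line_conditionsD:
  assumes "f \<in> line_conditions n" "distinct [i, j, k]"
  shows "f \<in> cone_ideal (codim2 i j k 0 0)"
    and "a \<in> roots_of_unity n \<Longrightarrow> b \<in> roots_of_unity n \<Longrightarrow> f \<in> cone_ideal (codim2 i j k a b)"
  using assms by (auto simp: line_conditions_def)

definition expo :: "nat \<Rightarrow> nat \<Rightarrow> nat \<Rightarrow> nat \<Rightarrow> 4 \<Rightarrow>\<^sub>0 nat"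
  where "expo a b c d = Poly_Mapping.single 1 a + Poly_Mapping.single 2 b +
    Poly_Mapping.single 3 c + Poly_Mapping.single 4 d"

lemma lookup_expo [simp]:
  "Poly_Mapping.lookup (expo a b c d) 1 = a" "Poly_Mapping.lookup (expo a b c d) 2 = b"
  "Poly_Mapping.lookup (expo a b c d) 3 = c" "Poly_Mapping.lookup (expo a b c d) 4 = d"
  by (simp_all add: expo_def lookup_add lookup_single)

lemma exponent_eq_iff:
  "m = m' \<longleftrightarrow> Poly_Mapping.lookup m 1 = Poly_Mapping.lookup m' 1 \<and>
    Poly_Mapping.lookup m 2 = Poly_Mapping.lookup m' 2 \<and>
    Poly_Mapping.lookup m 3 = Poly_Mapping.lookup m' 3 \<and>
    Poly_Mapping.lookup m (4 :: 4) = Poly_Mapping.lookup m' 4"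
  by (simp add: poly_mapping_eq_iff fun_eq_iff forall_4)

lemma expo_eq_iff [simp]: "expo a b c d = expo a' b' c' d' \<longleftrightarrow> a = a' \<and> b = b' \<and> c = c' \<and> d = d'"
  by (simp add: exponent_eq_iff)

lemma expo_add [simp]: "expo a b c d + expo a' b' c' d' = expo (a + a') (b + b') (c + c') (d + d')"
  by (simp add: exponent_eq_iff lookup_add)

text \<open>
  Use the relation between coefficients for the lines on which \<open>x\<^sub>i\<close> and \<open>x\<^sub>j\<close> are multiples of
  \<open>x\<^sub>l\<close>. An exponent below \<open>n\<close> is the least one in its residue class and the exponent of \<open>x\<^sub>l\<close> is
  zero, so the given sum of exponents admits no other monomial: the relation has a single term.
\<close>

lemma lookup_eq_0_of_two_small_exponents:
  fixes f :: "'k::field_char_0 poly4"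
  assumes prim: "primitive_root_of_unity n (\<epsilon> :: 'k)" and f: "f \<in> line_conditions n"
    and dist: "distinct [i, j, k, l]"
    and m: "Poly_Mapping.lookup m l = 0" "Poly_Mapping.lookup m i < n" "Poly_Mapping.lookup m j < n"
  shows "Poly_Mapping.lookup f m = 0"
proof -
  let ?e = "Poly_Mapping.lookup"
  let ?M = "{m' \<in> Poly_Mapping.keys f. ?e m' i mod n = ?e m i mod n \<and> ?e m' j mod n = ?e m j mod n \<and>
      ?e m' i + ?e m' j + ?e m' l = ?e m i + ?e m j \<and> ?e m' k = ?e m k}"
  have dist': "distinct [i, j, l, k]"
    using dist by auto
  have sum: "(\<Sum>m'\<in>?M. ?e f m') = 0"
    by (rule coeff_sum_eq_0[OF prim dist']) (use line_conditionsD(2)[OF f] dist in auto)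
  have "m' = m" if "m' \<in> ?M" for m'
  proof (rule poly_mapping_eqI)
    fix x
    have "?e m' i \<ge> ?e m i" "?e m' j \<ge> ?e m j"
      using that m mod_less_eq_dividend[of "?e m' i" n] mod_less_eq_dividend[of "?e m' j" n] by auto
    then have "?e m' i = ?e m i" "?e m' j = ?e m j" "?e m' l = ?e m l"
      using that m(1) by auto
    moreover have "x \<in> {i, j, k, l}"
      using UNIV_4_distinct[OF dist] by blast
    ultimately show "?e m' x = ?e m x"
      using that by auto
  qed
  then have "?M = {m} \<inter> Poly_Mapping.keys f"
    using m(1) by auto
  with sum show ?thesis
    by (cases "m \<in> Poly_Mapping.keys f") (auto simp: in_keys_iff)
qed

text \<open>
  For a monomial without \<open>w\<close>, positivity of the other exponents comes from the coordinate lines in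
  the plane \<open>w = 0\<close>.
\<close>

lemma w_free_exponents:
  fixes f :: "'k::field_char_0 poly4"
  assumes prim: "primitive_root_of_unity n (\<epsilon> :: 'k)" and f: "f \<in> line_conditions n"
    and nz: "Poly_Mapping.lookup f (expo a b c 0) \<noteq> 0"
  shows "a > 0" "b > 0" "c > 0" "a \<ge> n \<or> b \<ge> n" "a \<ge> n \<or> c \<ge> n" "b \<ge> n \<or> c \<ge> n"
proof -
  have pos: "Poly_Mapping.lookup (expo a b c 0) i > 0" if i: "i \<noteq> 4" for i
  proof -
    consider "distinct [4, i, 2, 3]" | "distinct [4, i, 1, 3]" | "distinct [4, i, 1, 2]"
      using i exhaust_4[of i] by auto
    then obtain j k where dist: "distinct [4, i, j, k]"
      by cases blast+
    have "distinct [4, i, j]"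
      using dist by simp
    then show ?thesis
      using nz lookup_eq_0_of_coordinate_line[OF dist line_conditionsD(1)[OF f], of "expo a b c 0"]
      by auto
  qed
  show "a > 0" "b > 0" "c > 0"
    using pos[of 1] pos[of 2] pos[of 3] by simp_all
  note small = lookup_eq_0_of_two_small_exponents[OF prim f, of _ _ _ _ "expo a b c 0"]
  show "a \<ge> n \<or> b \<ge> n" "a \<ge> n \<or> c \<ge> n" "b \<ge> n \<or> c \<ge> n"
    using nz small[of 1 2 3 4] small[of 1 3 2 4] small[of 2 3 1 4] by fastforce+
qed

text \<open>
  Consider the relation for the lines on which \<open>x\<close> and \<open>y\<close> are multiples of \<open>z\<close>, with the residues 0
  and \<open>r\<close> for the exponents of \<open>x\<close> and \<open>y\<close> and total degree \<open>2 * n + r + s\<close>. Two multiples of \<open>n\<close>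
  are to be distributed over the exponents \<open>(0, r, s)\<close>. The exponent of \<open>x\<close> is positive and at
  most one exponent is below \<open>n\<close>, which leaves the two displayed monomials.
\<close>

lemma w_free_coefficients_antisymmetric:
  fixes f :: "'k::field_char_0 poly4"
  assumes prim: "primitive_root_of_unity n (\<epsilon> :: 'k)" and f: "f \<in> line_conditions n"
    and rs: "r < n" "s < n"
  shows "Poly_Mapping.lookup f (expo n r (n + s) 0) = - Poly_Mapping.lookup f (expo n (n + r) s 0)"
proof -
  let ?e = "Poly_Mapping.lookup"
  let ?M = "{m \<in> Poly_Mapping.keys f. ?e m 1 mod n = 0 mod n \<and> ?e m 2 mod n = r mod n \<and>
      ?e m 1 + ?e m 2 + ?e m 3 = 2 * n + r + s \<and> ?e m 4 = 0}"
  have n: "n > 0"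
    using rs by simp
  have "(\<Sum>m\<in>?M. ?e f m) = 0"
    by (rule coeff_sum_eq_0[OF prim]) (use line_conditionsD(2)[OF f] in auto)
  also have "(\<Sum>m\<in>?M. ?e f m) = (\<Sum>m\<in>{expo n r (n + s) 0, expo n (n + r) s 0}. ?e f m)"
  proof (rule sum.mono_neutral_left)
    show "?M \<subseteq> {expo n r (n + s) 0, expo n (n + r) s 0}"
    proof
      fix m assume m: "m \<in> ?M"
      obtain a b c where abc: "m = expo a b c 0"
        using m by (auto simp: exponent_eq_iff)
      have nz: "?e f (expo a b c 0) \<noteq> 0"
        using m abc by (auto simp: in_keys_iff)
      note exps = w_free_exponents[OF prim f nz]
      have sum: "a + b + c = 2 * n + r + s"
        using m abc by simp
      obtain p where p: "a = n * p"
        using m abc n by auto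
      \<comment> \<open>\<open>p\<close> and \<open>q\<close> count the multiples of \<open>n\<close> given to \<open>x\<close> and \<open>y\<close>; \<open>z\<close> receives the remaining \<open>2 - p - q\<close>.\<close>
      define q where "q = b div n"
      have q: "b = n * q + r"
        using m abc rs mult_div_mod_eq[of n b] by (simp add: q_def)
      have "p > 0"
        using exps(1) p by (cases p) auto
      have "p + q \<le> 2"
      proof (rule ccontr)
        assume "\<not> p + q \<le> 2"
        then have "n * 3 \<le> n * (p + q)"
          by (intro mult_le_mono2) simp
        then show False
          using sum p q rs by (simp add: algebra_simps)
      qed
      then consider "p = 1" "q = 0" | "p = 1" "q = 1" | "p = 2" "q = 0"
        using \<open>p > 0\<close> by linarith
      then show "m \<in> {expo n r (n + s) 0, expo n (n + r) s 0}"
        by cases (use sum p q abc exps rs in auto)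
    qed
    show "\<forall>m\<in>{expo n r (n + s) 0, expo n (n + r) s 0} - ?M. ?e f m = 0"
      using rs by (auto simp: in_keys_iff)
  qed simp
  also have "\<dots> = ?e f (expo n r (n + s) 0) + ?e f (expo n (n + r) s 0)"
    using n by simp
  finally show ?thesis
    by (simp add: eq_neg_iff_add_eq_0)
qed

text \<open>
  A coefficient of a product is a sum over all factorizations of the monomial. It may be
  taken over any family of distinct factorizations that contains the ones with nonzero coefficients.
\<close>

lemma lookup_mult_reindex:
  fixes f g :: "('a::cancel_comm_monoid_add) \<Rightarrow>\<^sub>0 ('b::comm_semiring_1)"
  assumes "finite T" "inj_on \<phi> T" and sum: "\<And>t. t \<in> T \<Longrightarrow> \<phi> t + \<psi> t = m"
    and supp: "\<And>a b. a + b = m \<Longrightarrow> Poly_Mapping.lookup f a \<noteq> 0 \<Longrightarrow> Poly_Mapping.lookup g b \<noteq> 0 \<Longrightarrow> a \<in> \<phi> ` T"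
  shows "Poly_Mapping.lookup (f * g) m =
    (\<Sum>t\<in>T. Poly_Mapping.lookup f (\<phi> t) * Poly_Mapping.lookup g (\<psi> t))"
proof -
  let ?l = "Poly_Mapping.lookup"
  let ?h = "\<lambda>p. if fst p + snd p = m then ?l f (fst p) * ?l g (snd p) else 0"
  let ?K = "Poly_Mapping.keys f \<times> Poly_Mapping.keys g" and ?D = "(\<lambda>t. (\<phi> t, \<psi> t)) ` T"
  have "?l (f * g) m = ?l ((\<Sum>a\<in>Poly_Mapping.keys f. Poly_Mapping.single a (?l f a)) *
      (\<Sum>b\<in>Poly_Mapping.keys g. Poly_Mapping.single b (?l g b))) m"
    using poly_mapping_eq_sum_single[of f] poly_mapping_eq_sum_single[of g] by simp
  also have "\<dots> = (\<Sum>p\<in>?K. ?h p)"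
    by (simp add: sum_product mult_single lookup_sum lookup_single when_def sum.cartesian_product case_prod_beta)
  also have "\<dots> = (\<Sum>p\<in>?K \<union> ?D. ?h p)"
    using assms(1) by (intro sum.mono_neutral_left) (auto simp: in_keys_iff)
  also have "\<dots> = (\<Sum>p\<in>?D. ?h p)"
  proof (rule sum.mono_neutral_right)
    show "\<forall>p\<in>(?K \<union> ?D) - ?D. ?h p = 0"
    proof
      fix p assume p: "p \<in> (?K \<union> ?D) - ?D"
      show "?h p = 0"
      proof (rule ccontr)
        assume "?h p \<noteq> 0"
        then have *: "fst p + snd p = m" "?l f (fst p) \<noteq> 0" "?l g (snd p) \<noteq> 0"
          by (auto split: if_splits)
        then obtain t where t: "t \<in> T" "fst p = \<phi> t"
          using supp by blast
        then have "\<phi> t + snd p = \<phi> t + \<psi> t"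
          using sum[of t] *(1) by simp
        then have "snd p = \<psi> t"
          by (rule add_left_imp_eq)
        then show False
          using p t by (auto simp: prod_eq_iff image_iff)
      qed
    qed
  qed (use assms(1) in auto)
  also have "\<dots> = (\<Sum>t\<in>T. ?h (\<phi> t, \<psi> t))"
    using assms(2) by (subst sum.reindex) (auto simp: inj_on_def)
  also have "\<dots> = (\<Sum>t\<in>T. ?l f (\<phi> t) * ?l g (\<psi> t))"
    using sum by (intro sum.cong) auto
  finally show ?thesis .
qed

text \<open>
  In the monomial with exponents \<open>(2 * n, 3 * n, n)\<close> the exponent \<open>n\<close> of \<open>z\<close> is split into two
  positive parts, both below \<open>n\<close>. So in each factor the exponents of \<open>x\<close> and \<open>y\<close> are at least \<open>n\<close>,
  and \<open>2 * n\<close> splits as \<open>n + n\<close>. The exponents of the first factor are therefore \<open>(n, n + r, s)\<close> and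
  those of the second are \<open>(n, 2 * n - r, n - s)\<close>. The other coefficient is treated in the same way
  with \<open>y\<close> and \<open>z\<close> interchanged. The relation between the coefficients in
  each factor matches the two sums term by term, as the two signs cancel.
\<close>

lemma square_coefficients_eq:
  fixes f g :: "'k::field_char_0 poly4"
  assumes prim: "primitive_root_of_unity n (\<epsilon> :: 'k)"
    and f: "f \<in> line_conditions n" and g: "g \<in> line_conditions n"
  shows "Poly_Mapping.lookup (f * g) (expo (2 * n) (3 * n) n 0) =
    Poly_Mapping.lookup (f * g) (expo (2 * n) n (3 * n) 0)"
proof -
  let ?l = "Poly_Mapping.lookup"
  let ?T = "{1..<n} \<times> {1..<n}"
  have n: "n > 0"
    using prim by (simp add: primitive_root_of_unity_def)
  note antisym_f = w_free_coefficients_antisymmetric[OF prim f]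
  note antisym_g = w_free_coefficients_antisymmetric[OF prim g]
  have zero: "?l h (expo n n s 0) = 0 \<and> ?l h (expo n s n 0) = 0"
    if "s < n" and h: "h \<in> line_conditions n" for s and h :: "'k poly4"
  proof -
    have "?l h (expo n 0 (n + s) 0) = 0" "?l h (expo n (n + s) 0 0) = 0"
      using w_free_exponents(2,3)[OF prim h] by blast+
    then show ?thesis
      using w_free_coefficients_antisymmetric[OF prim h, of 0 s]
        w_free_coefficients_antisymmetric[OF prim h, of s 0] \<open>s < n\<close> n by simp
  qed
  have "?l (f * g) (expo (2 * n) (3 * n) n 0) =
      (\<Sum>t\<in>?T. ?l f (expo n (n + fst t) (snd t) 0) * ?l g (expo n (n + (n - fst t)) (n - snd t) 0))"
  proof (rule lookup_mult_reindex)
    fix a b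
    assume ab: "a + b = expo (2 * n) (3 * n) n 0" and nz: "?l f a \<noteq> 0" "?l g b \<noteq> 0"
    obtain a1 a2 a3 where a: "a = expo a1 a2 a3 0"
      using ab by (auto simp: exponent_eq_iff lookup_add)
    obtain b1 b2 b3 where b: "b = expo b1 b2 b3 0"
      using ab by (auto simp: exponent_eq_iff lookup_add)
    have sums: "a1 + b1 = 2 * n" "a2 + b2 = 3 * n" "a3 + b3 = n"
      using ab by (simp_all add: a b)
    note ea = w_free_exponents[OF prim f nz(1)[unfolded a]]
    note eb = w_free_exponents[OF prim g nz(2)[unfolded b]]
    have a3: "0 < a3" "a3 < n" "0 < b3" "b3 < n"
      using sums ea(3) eb(3) by linarith+
    have 1: "a1 = n" "b1 = n"
      using sums a3 ea eb by linarith+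
    have 2: "a2 \<ge> n" "b2 \<ge> n"
      using a3 ea eb by linarith+
    have 3: "a2 \<noteq> n" "b2 \<noteq> n"
      using zero nz a3 1 f g by (auto simp: a b)
    show "a \<in> (\<lambda>t. expo n (n + fst t) (snd t) 0) ` ?T"
      by (rule image_eqI[of _ _ "(a2 - n, a3)"]) (use a 1 2 3 a3 sums in auto)
  qed (auto simp: inj_on_def)
  also have "\<dots> = (\<Sum>t\<in>?T. ?l f (expo n (fst t) (n + snd t) 0) * ?l g (expo n (n - fst t) (n + (n - snd t)) 0))"
  proof (rule sum.cong)
    fix t assume "t \<in> ?T"
    then have "fst t < n" "snd t < n" "n - fst t < n" "n - snd t < n"
      by auto
    then show "?l f (expo n (n + fst t) (snd t) 0) * ?l g (expo n (n + (n - fst t)) (n - snd t) 0) =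
        ?l f (expo n (fst t) (n + snd t) 0) * ?l g (expo n (n - fst t) (n + (n - snd t)) 0)"
      by (simp only: antisym_f antisym_g minus_mult_minus)
  qed simp
  also have "\<dots> = ?l (f * g) (expo (2 * n) n (3 * n) 0)"
  proof (rule lookup_mult_reindex[symmetric])
    fix a b
    assume ab: "a + b = expo (2 * n) n (3 * n) 0" and nz: "?l f a \<noteq> 0" "?l g b \<noteq> 0"
    obtain a1 a2 a3 where a: "a = expo a1 a2 a3 0"
      using ab by (auto simp: exponent_eq_iff lookup_add)
    obtain b1 b2 b3 where b: "b = expo b1 b2 b3 0"
      using ab by (auto simp: exponent_eq_iff lookup_add)
    have sums: "a1 + b1 = 2 * n" "a2 + b2 = n" "a3 + b3 = 3 * n"
      using ab by (simp_all add: a b)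
    note ea = w_free_exponents[OF prim f nz(1)[unfolded a]]
    note eb = w_free_exponents[OF prim g nz(2)[unfolded b]]
    have a2: "0 < a2" "a2 < n" "0 < b2" "b2 < n"
      using sums ea(2) eb(2) by linarith+
    have 1: "a1 = n" "b1 = n"
      using sums a2 ea eb by linarith+
    have 2: "a3 \<ge> n" "b3 \<ge> n"
      using a2 ea eb by linarith+
    have 3: "a3 \<noteq> n" "b3 \<noteq> n"
      using zero nz a2 1 f g by (auto simp: a b)
    show "a \<in> (\<lambda>t. expo n (fst t) (n + snd t) 0) ` ?T"
      by (rule image_eqI[of _ _ "(a2, a3 - n)"]) (use a 1 2 3 a2 sums in auto)
  qed (auto simp: inj_on_def)
  finally show ?thesis .
qed

text \<open>
  Modulo \<open>w\<close> the product is \<open>x * y * z\<close> times the Vandermonde product of \<open>x\<close>, \<open>y\<close>, \<open>z\<close>. It is used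
  with the \<open>n\<close>-th powers of the variables.
\<close>

lemma fermat_product_mod_w:
  fixes x y z w :: "'a::comm_ring_1"
  shows "(x - y) * (x - z) * (x - w) * (y - z) * (y - w) * (z - w) =
    w * (- (x - y) * (x - z) * (y - z) * (x * y + x * z + y * z - w * x - w * y - w * z + w * w)) +
    (x * x * x * (y * y) * z - x * x * x * y * (z * z) - x * x * (y * y * y) * z
      + x * x * y * (z * z * z) + x * (y * y * y) * (z * z) - x * (y * y) * (z * z * z))"
  by (simp add: algebra_simps)

lemma fermat_poly_coefficients:
  assumes "n > 0"
  shows "Poly_Mapping.lookup (fermat_poly n :: 'k::field poly4) (expo (2 * n) (3 * n) n 0) = -1"
    and "Poly_Mapping.lookup (fermat_poly n :: 'k::field poly4) (expo (2 * n) n (3 * n) 0) = 1"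
proof -
  define mono :: "nat \<Rightarrow> nat \<Rightarrow> nat \<Rightarrow> nat \<Rightarrow> 'k poly4"
    where "mono a b c d = Poly_Mapping.single (expo a b c d) 1" for a b c d
  have mono_mult: "mono a b c d * mono a' b' c' d' = mono (a + a') (b + b') (c + c') (d + d')"
    for a b c d a' b' c' d'
    by (simp add: mono_def mult_single)
  have Var_eq: "Var 1 = mono 1 0 0 0" "Var 2 = mono 0 1 0 0" "Var 3 = mono 0 0 1 0" "Var 4 = mono 0 0 0 1"
    by (simp_all add: Var_def mono_def expo_def)
  have "mono 0 0 0 0 = 1"
    by (simp add: mono_def expo_def)
  then have pow: "mono a b c d ^ k = mono (k * a) (k * b) (k * c) (k * d)" for a b c d k
    by (induction k) (simp_all add: mono_mult)
  have Var_pow: "Var 1 ^ k = mono k 0 0 0" "Var 2 ^ k = mono 0 k 0 0" "Var 3 ^ k = mono 0 0 k 0"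
    "Var 4 ^ k = mono 0 0 0 k" for k
    by (simp_all add: Var_eq pow)
  define x y z w where "x = mono n 0 0 0" and "y = mono 0 n 0 0" and "z = mono 0 0 n 0" and "w = mono 0 0 0 n"
  define G where "G = - (x - y) * (x - z) * (y - z) * (x * y + x * z + y * z - w * x - w * y - w * z + w * w)"
  have "fermat_poly n = (x - y) * (x - z) * (x - w) * (y - z) * (y - w) * (z - w)"
    by (simp add: fermat_poly_def Var_pow x_def y_def z_def w_def)
  also have "\<dots> = w * G + (x * x * x * (y * y) * z - x * x * x * y * (z * z) - x * x * (y * y * y) * z
      + x * x * y * (z * z * z) + x * (y * y * y) * (z * z) - x * (y * y) * (z * z * z))"
    unfolding G_def by (rule fermat_product_mod_w)
  also have "x * x * x * (y * y) * z - x * x * x * y * (z * z) - x * x * (y * y * y) * z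
      + x * x * y * (z * z * z) + x * (y * y * y) * (z * z) - x * (y * y) * (z * z * z) =
      mono (3 * n) (2 * n) n 0 - mono (3 * n) n (2 * n) 0 - mono (2 * n) (3 * n) n 0
      + mono (2 * n) n (3 * n) 0 + mono n (3 * n) (2 * n) 0 - mono n (2 * n) (3 * n) 0"
  proof -
    have "2 * n = n + n" "3 * n = n + n + n"
      by simp_all
    then show ?thesis
      by (simp only: x_def y_def z_def mono_mult add_0_left add_0_right)
  qed
  finally have F: "fermat_poly n = w * G + \<dots>" .
  have "Poly_Mapping.lookup (w * G) (expo a b c 0) = 0" for a b c
  proof -
    have "Poly_Mapping.lookup (w * G) (expo a b c 0) =
        (\<Sum>t\<in>{}. Poly_Mapping.lookup w t * Poly_Mapping.lookup G t)"
    proof (rule lookup_mult_reindex)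
      fix p q assume "p + q = expo a b c 0" "Poly_Mapping.lookup w p \<noteq> 0"
      then show "p \<in> (\<lambda>t. t) ` {}"
        using assms by (auto simp: w_def mono_def lookup_single exponent_eq_iff lookup_add when_def split: if_splits)
    qed auto
    then show ?thesis
      by simp
  qed
  then show "Poly_Mapping.lookup (fermat_poly n :: 'k::field poly4) (expo (2 * n) (3 * n) n 0) = -1"
    and "Poly_Mapping.lookup (fermat_poly n :: 'k::field poly4) (expo (2 * n) n (3 * n) 0) = 1"
    using assms by (simp_all add: F lookup_add lookup_minus mono_def lookup_single when_def)
qed

lemma ideal_square_coefficients_eq:
  assumes prim: "primitive_root_of_unity n (\<epsilon> :: 'k::field_char_0)"
    and I: "(I :: 'k poly4 set) \<subseteq> line_conditions n" "ideal I ring_of_type_algebra"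
    and h: "h \<in> ideal_power I 2"
  shows "Poly_Mapping.lookup h (expo (2 * n) (3 * n) n 0) =
    Poly_Mapping.lookup h (expo (2 * n) n (3 * n) 0)"
proof -
  have "h \<in> ideal_power I (Suc 1)"
    using h by (simp add: numeral_2_eq_2)
  then show ?thesis
  proof (induction rule: ideal_power_induct)
    case (mult a b)
    from mult(1) have "a \<in> ideal_power I (Suc 0)"
      by simp
    then have "a \<in> I"
    proof (induction rule: ideal_power_induct)
      case (mult a b)
      then show ?case
        using ideal.I_l_closed[OF I(2), of b a] by (simp add: ring_of_type_algebra_def)
    next
      case (add a b)
      then show ?case
        using additive_subgroup.a_closed[OF ideal.axioms(1)[OF I(2)], of a b]
        by (simp add: ring_of_type_algebra_def)
    qed
    with mult(2) I(1) show ?case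
      by (intro square_coefficients_eq[OF prim]) auto
  next
    case (add a b)
    then show ?case by (simp add: lookup_add)
  qed
qed


section \<open>Linear subspaces of projective space\<close>

text \<open>
  In the hyperplanes and lines below, every coordinate is a fixed multiple of one of the free
  coordinates in \<open>S\<close>. A basis is obtained by setting one free coordinate to 1 and the other free ones to 0.
\<close>

lemma dim_graph_subspace:
  fixes c :: "'n::finite \<Rightarrow> 'k::field"
  assumes "\<And>s. s \<in> S \<Longrightarrow> r s = s \<and> c s = 1" and "\<And>m. r m \<in> S"
  shows "vec.dim {v :: 'k^'n. \<forall>m. v $ m = c m * v $ r m} = card S"
proof -
  let ?W = "{v :: 'k^'n. \<forall>m. v $ m = c m * v $ r m}"
  define b where "b s = (\<chi> m. if r m = s then c m else 0)" for s
  have b: "b s $ t = (if s = t then 1 else 0)" if "s \<in> S" "t \<in> S" for s t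
    using assms(1) that by (auto simp: b_def)
  have inj: "inj_on b S"
  proof (rule inj_onI)
    fix s t assume st: "s \<in> S" "t \<in> S" "b s = b t"
    then show "s = t"
      using b[of s t] b[of t t] by (simp split: if_splits)
  qed
  show ?thesis
  proof (rule vec.dim_unique)
    show "b ` S \<subseteq> ?W"
      using assms by (auto simp: b_def)
    show "?W \<subseteq> vec.span (b ` S)"
    proof
      fix v assume "v \<in> ?W"
      have "v $ m = (\<Sum>s\<in>S. v $ s *s b s) $ m" for m
      proof -
        have "(\<Sum>s\<in>S. v $ s *s b s) $ m = (\<Sum>s\<in>S. if r m = s then v $ s * c m else 0)"
          unfolding sum_component vector_smult_component b_def by (intro sum.cong) auto
        also have "\<dots> = c m * v $ r m"
          using assms(2) by (simp add: mult.commute)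
        also have "\<dots> = v $ m"
          using \<open>v \<in> ?W\<close> by (intro sym[of "v $ m"]) blast
        finally show ?thesis ..
      qed
      then have "v = (\<Sum>s\<in>S. v $ s *s b s)"
        unfolding vec_eq_iff by blast
      also have "\<dots> \<in> vec.span (b ` S)"
        by (intro vec.span_sum vec.span_scale vec.span_base) auto
      finally show "v \<in> vec.span (b ` S)" .
    qed
    show "vec.independent (b ` S)"
    proof
      assume "vec.dependent (b ` S)"
      then obtain u where u: "\<exists>s\<in>S. u (b s) \<noteq> 0" "(\<Sum>v\<in>b ` S. u v *s v) = 0"
        by (auto simp: vec.dependent_finite)
      have "u (b t) = 0" if "t \<in> S" for t
      proof -
        have "0 = (\<Sum>s\<in>S. u (b s) *s b s) $ t"
          using u(2) by (simp add: sum.reindex[OF inj])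
        also have "\<dots> = (\<Sum>s\<in>S. if s = t then u (b s) else 0)"
          unfolding sum_component vector_smult_component by (intro sum.cong) (use that b in auto)
        also have "\<dots> = u (b t)"
          using that by simp
        finally show ?thesis ..
      qed
      then show False
        using u(1) by blast
    qed
    show "card (b ` S) = card S"
      by (rule card_image[OF inj])
  qed
qed

text \<open>
  In this form intersections and inclusions of linear subspaces of projective space reduce to those
  of the subspaces of coordinate vectors.
\<close>

lemma projectivization_eq:
  assumes "vec.subspace W"
  shows "projectivization W = {p \<in> proj_space. p \<subseteq> W}"
proof -
  have self: "v \<in> proportional `` {v}" if "v \<noteq> 0" for v :: "'a^4"
    using that by (auto simp: proportional_def intro!: exI[of _ 1])
  have sub: "proportional `` {v} \<subseteq> W" if "v \<in> W" for v
    using that vec.subspace_scale[OF assms] by (auto simp: proportional_def)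
  show ?thesis
  proof (intro equalityI subsetI)
    fix p assume "p \<in> projectivization W"
    then obtain v where v: "v \<in> W - {0}" "p = proportional `` {v}"
      unfolding projectivization_def by (rule quotientE)
    then have "p \<in> proj_space"
      unfolding proj_space_def projectivization_def by (auto intro: quotientI)
    then show "p \<in> {p \<in> proj_space. p \<subseteq> W}"
      using v sub by simp
  next
    fix p assume p: "p \<in> {p \<in> proj_space. p \<subseteq> W}"
    then obtain v where v: "v \<in> UNIV - {0}" "p = proportional `` {v}"
      unfolding proj_space_def projectivization_def by (auto elim: quotientE)
    then have "v \<in> W - {0}"
      using self[of v] p by auto
    then show "p \<in> projectivization W"
      unfolding projectivization_def v(2) by (rule quotientI)
  qed
qed

lemma projectivization_subset_iff:
  assumes "vec.subspace W" "vec.subspace W'"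
  shows "projectivization W \<subseteq> projectivization W' \<longleftrightarrow> W \<subseteq> W'"
proof
  assume sub: "projectivization W \<subseteq> projectivization W'"
  show "W \<subseteq> W'"
  proof
    fix v assume v: "v \<in> W"
    show "v \<in> W'"
    proof (cases "v = 0")
      case True
      then show ?thesis
        using vec.subspace_0[OF assms(2)] by simp
    next
      case False
      then have "proportional `` {v} \<in> projectivization W"
        using v by (auto simp: projectivization_def quotient_def)
      then have "proportional `` {v} \<subseteq> W'"
        using sub by (auto simp: projectivization_eq[OF assms(2)])
      moreover have "v \<in> proportional `` {v}"
        using False by (auto simp: proportional_def intro!: exI[of _ 1])
      ultimately show ?thesis ..
    qed
  qed
qed (use assms in \<open>auto simp: projectivization_eq\<close>)

lemma projectivization_Inter:
  assumes "\<And>W. W \<in> \<W> \<Longrightarrow> vec.subspace W" "\<W> \<noteq> {}"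
  shows "(\<Inter>W\<in>\<W>. projectivization W) = projectivization (\<Inter>\<W>)"
proof -
  have "vec.subspace (\<Inter>\<W>)"
    using assms(1) by (intro vec.subspace_Inter) auto
  then show ?thesis
    using assms by (auto simp: projectivization_eq)
qed

text \<open>
  A projective point does not contain the zero vector, but a polynomial in one variable that vanishes
  at all nonzero scalars of an infinite field also vanishes at 0.
\<close>

lemma eval_at_zero:
  fixes w :: "'k::field_char_0^4"
  assumes "w \<noteq> 0" "\<And>c. c \<noteq> 0 \<Longrightarrow> eval f (c *s w) = 0"
  shows "eval f 0 = 0"
proof -
  obtain p where p: "\<And>c. eval f (0 + c *s w) = poly p c"
    using eval_along_affine_line[of f 0 w] by metis
  have "poly ([:0, 1:] * p) c = 0" for c
    using assms(2)[of c] p[of c] by (cases "c = 0") auto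
  then have "[:0, 1:] * p = 0"
    using poly_all_0_iff_0 by blast
  then have "p = 0"
    by simp
  then show ?thesis
    using p[of 0] by simp
qed

lemma vanishing_ideal_projectivization:
  fixes W :: "('k::field_char_0^4) set"
  assumes "vec.subspace W" "vec.dim W > 0"
  shows "vanishing_ideal (projectivization W) = cone_ideal W"
proof -
  obtain w where w: "w \<in> W" "w \<noteq> 0"
    using assms(2) iffD2[OF vec.dim_eq_0, of W] by (cases "W \<subseteq> {0}") auto
  have scale: "c *s v \<in> W" if "v \<in> W" for c v
    using vec.subspace_scale[OF assms(1) that] .
  have "f \<in> vanishing_ideal (projectivization W) \<longleftrightarrow> (\<forall>v\<in>W - {0}. eval f v = 0)" for f
  proof
    assume f: "f \<in> vanishing_ideal (projectivization W)"
    show "\<forall>v\<in>W - {0}. eval f v = 0"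
    proof
      fix v assume v: "v \<in> W - {0}"
      then have "proportional `` {v} \<in> projectivization W"
        by (auto simp: projectivization_def quotient_def)
      moreover have "v \<in> proportional `` {v}"
        using v by (auto simp: proportional_def intro!: exI[of _ 1])
      ultimately show "eval f v = 0"
        using f by (auto simp: vanishing_ideal_def vanishes_at_def)
    qed
  next
    assume "\<forall>v\<in>W - {0}. eval f v = 0"
    then show "f \<in> vanishing_ideal (projectivization W)"
      using scale by (auto simp: vanishing_ideal_def vanishes_at_def projectivization_def
        quotient_def proportional_def)
  qed
  moreover
  have "(\<forall>v\<in>W - {0}. eval f v = 0) \<longleftrightarrow> f \<in> cone_ideal W" for f
  proof
    assume f: "\<forall>v\<in>W - {0}. eval f v = 0"
    then have "eval f 0 = 0"
      using w scale by (intro eval_at_zero[of w]) auto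
    then have "eval f v = 0" if "v \<in> W" for v
      using f that by (cases "v = 0") auto
    then show "f \<in> cone_ideal W"
      by (simp add: cone_ideal_def)
  qed (simp add: cone_ideal_def)
  ultimately show ?thesis
    by blast
qed


section \<open>The planes and lines of the Fermat arrangement\<close>

definition hyperplane :: "4 \<Rightarrow> 4 \<Rightarrow> 'k::field \<Rightarrow> ('k^4) set"
  where "hyperplane i j a = {v. v $ i = a * v $ j}"

lemma subspace_hyperplane: "vec.subspace (hyperplane i j a)"
  by (auto simp: vec.subspace_def hyperplane_def algebra_simps)

lemma dim_hyperplane:
  assumes "i \<noteq> j"
  shows "vec.dim (hyperplane i j a :: ('k::field^4) set) = 3"
proof -
  have "hyperplane i j a = {v :: 'k^4. \<forall>m. v $ m = (if m = i then a else 1) * v $ (if m = i then j else m)}"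
    by (auto simp: hyperplane_def)
  also have "vec.dim \<dots> = card (- {i})"
    by (rule dim_graph_subspace) (use assms in auto)
  also have "\<dots> = 3"
    by (simp add: Compl_eq_Diff_UNIV card_Diff_subset)
  finally show ?thesis .
qed

lemma subspace_codim2: "vec.subspace (codim2 i j k a b)"
  by (auto simp: vec.subspace_def codim2_def algebra_simps)

lemma dim_codim2:
  assumes "distinct [i, j, k]"
  shows "vec.dim (codim2 i j k a b :: ('k::field^4) set) = 2"
proof -
  have "codim2 i j k a b = {v :: 'k^4. \<forall>m. v $ m =
      (if m = i then a else if m = j then b else 1) * v $ (if m \<in> {i, j} then k else m)}"
    (is "_ = ?W")
  proof (intro equalityI subsetI)
    fix v :: "'k^4" assume "v \<in> ?W"
    then have "v $ m = (if m = i then a else if m = j then b else 1) * v $ (if m \<in> {i, j} then k else m)" for m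
      by blast
    from this[of i] this[of j] show "v \<in> codim2 i j k a b"
      using assms by (auto simp: codim2_def)
  qed (use assms in \<open>auto simp: codim2_def\<close>)
  also have "vec.dim \<dots> = card (- {i, j})"
    by (rule dim_graph_subspace) (use assms in auto)
  also have "\<dots> = 2"
    using assms by (simp add: Compl_eq_Diff_UNIV card_Diff_subset)
  finally show ?thesis .
qed

definition plane_form :: "4 \<times> 4 \<times> 'k::field \<Rightarrow> 'k poly4"
  where "plane_form = (\<lambda>(i, j, a). Var i - Const a * Var j)"

definition plane_of :: "4 \<times> 4 \<times> 'k::field \<Rightarrow> 'k point set"
  where "plane_of = (\<lambda>(i, j, a). projectivization (hyperplane i j a))"

text \<open>
  Every pair of variables is listed once. The order of the index type does not serve for this
  purpose, since 4 equals 0 there and comes first.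
\<close>

definition index_pairs :: "(4 \<times> 4) set"
  where "index_pairs = {(1, 2), (1, 3), (1, 4), (2, 3), (2, 4), (3, 4)}"

definition fermat_indices :: "nat \<Rightarrow> (4 \<times> 4 \<times> 'k::field) set"
  where "fermat_indices n = {(i, j, a). (i, j) \<in> index_pairs \<and> a \<in> roots_of_unity n}"

lemma plane_form_in_cone_ideal: "plane_form (i, j, a) \<in> cone_ideal W \<longleftrightarrow> W \<subseteq> hyperplane i j a"
  by (auto simp: plane_form_def cone_ideal_def hyperplane_def)


lemma index_pairs_neq: "(i, j) \<in> index_pairs \<Longrightarrow> i \<noteq> j"
  by (auto simp: index_pairs_def)

lemma fermat_indices_eq_image:
  "fermat_indices n = (\<lambda>((i, j), a). (i, j, a)) ` (index_pairs \<times> roots_of_unity n)"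
proof (intro equalityI subsetI)
  fix x :: "4 \<times> 4 \<times> 'a" assume "x \<in> fermat_indices n"
  then obtain i j a where "x = (i, j, a)" "(i, j) \<in> index_pairs" "a \<in> roots_of_unity n"
    by (auto simp: fermat_indices_def)
  then show "x \<in> (\<lambda>((i, j), a). (i, j, a)) ` (index_pairs \<times> roots_of_unity n)"
    by (intro image_eqI[of _ _ "((i, j), a)"]) auto
qed (auto simp: fermat_indices_def)

lemma finite_fermat_indices: "n > 0 \<Longrightarrow> finite (fermat_indices n :: (4 \<times> 4 \<times> 'k::field) set)"
  unfolding fermat_indices_eq_image
  by (intro finite_imageI finite_cartesian_product roots_of_unity_finite_card_le) (simp_all add: index_pairs_def)

lemma fermat_poly_eq_prod_plane_forms:
  assumes prim: "primitive_root_of_unity n (\<epsilon> :: 'k::field)"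
  shows "(fermat_poly n :: 'k poly4) = (\<Prod>x\<in>fermat_indices n. plane_form x)"
proof -
  have n: "n > 0"
    using prim by (simp add: primitive_root_of_unity_def)
  have Const_power: "Const a ^ k = Const (a ^ k)" for a :: 'k and k
    by (induction k) (simp_all add: mult_single)
  have pair: "(\<Prod>a\<in>roots_of_unity n. plane_form (i, j, a)) = Var i ^ n - (Var j ^ n :: 'k poly4)" for i j
  proof -
    have inj: "inj_on Const (roots_of_unity n :: 'k set)"
      using inj_single[of "0 :: 4 \<Rightarrow>\<^sub>0 nat"] by (rule inj_on_subset) simp
    have card: "card (Const ` (roots_of_unity n :: 'k set)) = n"
      using card_image[OF inj] card_roots_of_unity[OF prim] by simp
    have "Var i ^ n - Var j ^ n = (\<Prod>a\<in>Const ` (roots_of_unity n :: 'k set). Var i - a * Var j)"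
      by (rule power_diff_power_factor)
        (use n card roots_of_unity_finite_card_le(1)[OF n] in
          \<open>auto simp: Const_power roots_of_unity_def\<close>)
    then show ?thesis
      by (simp add: prod.reindex[OF inj] plane_form_def)
  qed
  have "(\<Prod>x\<in>fermat_indices n. plane_form x) =
      (\<Prod>p\<in>index_pairs \<times> (roots_of_unity n :: 'k set). plane_form (fst (fst p), snd (fst p), snd p))"
    unfolding fermat_indices_eq_image
    by (subst prod.reindex) (auto simp: inj_on_def case_prod_beta)
  also have "\<dots> = (\<Prod>p\<in>index_pairs. \<Prod>a\<in>(roots_of_unity n :: 'k set). plane_form (fst p, snd p, a))"
    by (simp add: prod.cartesian_product case_prod_beta)
  also have "\<dots> = fermat_poly n"
    by (simp add: pair index_pairs_def fermat_poly_def Let_def mult.assoc)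
  finally show ?thesis ..
qed

lemma fermat_poly_in_cone_ideal_hyperplane:
  assumes "a \<in> roots_of_unity n" "i \<noteq> j"
  shows "fermat_poly n \<in> cone_ideal (hyperplane i j a)"
proof -
  have eval_power: "eval (f ^ k) v = eval f v ^ k" for f :: "'a poly4" and k v
    by (induction k) simp_all
  show ?thesis
    using exhaust_4[of i] exhaust_4[of j] assms
    by (auto simp: fermat_poly_def cone_ideal_def hyperplane_def eval_power Let_def
      roots_of_unity_def power_mult_distrib)
qed

lemma projectivization_subset_zero_locus_iff:
  fixes W :: "('k::field_char_0^4) set"
  assumes "vec.subspace W" "vec.dim W > 0"
  shows "projectivization W \<subseteq> zero_locus f \<longleftrightarrow> f \<in> cone_ideal W"
proof -
  have "projectivization W \<subseteq> proj_space"
    by (auto simp: projectivization_eq[OF assms(1)])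
  then show ?thesis
    unfolding vanishing_ideal_projectivization[OF assms, symmetric]
    by (auto simp: zero_locus_def vanishing_ideal_def)
qed

lemma hyperplane_in_arrangement:
  fixes a :: "'k::field_char_0"
  assumes "a \<in> roots_of_unity n" "i \<noteq> j"
  shows "projectivization (hyperplane i j a) \<in> fermat_arrangement n"
proof -
  have "projectivization (hyperplane i j a) \<in> planes"
    unfolding linear_subspaces_def using subspace_hyperplane dim_hyperplane[OF assms(2)] by force
  moreover have "projectivization (hyperplane i j a) \<subseteq> zero_locus (fermat_poly n)"
    using fermat_poly_in_cone_ideal_hyperplane[OF assms] dim_hyperplane[OF assms(2), of a]
    by (subst projectivization_subset_zero_locus_iff) (simp_all add: subspace_hyperplane)
  ultimately show ?thesis
    by (simp add: fermat_arrangement_def)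
qed

text \<open>
  A plane on which the product of linear forms vanishes lies in the zero set of one of them, since
  the ideal of the plane is prime, and then both have the same dimension. In particular the
  arrangement is finite; the multiplicities are cardinalities of sets of its planes and would
  be 0 for infinite sets.
\<close>

lemma fermat_arrangement_eq:
  assumes prim: "primitive_root_of_unity n (\<epsilon> :: 'k::field_char_0)"
  shows "(fermat_arrangement n :: 'k point set set) = plane_of ` fermat_indices n"
proof (intro equalityI subsetI)
  fix H :: "'k point set" assume H: "H \<in> fermat_arrangement n"
  then obtain W where W: "vec.subspace W" "vec.dim W = 3" "H = projectivization W"
    by (auto simp: fermat_arrangement_def linear_subspaces_def)
  have n: "n > 0"
    using prim by (simp add: primitive_root_of_unity_def)
  have "fermat_poly n \<in> cone_ideal W"
    using H W projectivization_subset_zero_locus_iff[of W "fermat_poly n"] by (simp add: fermat_arrangement_def)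
  then obtain x where x: "x \<in> fermat_indices n" "plane_form x \<in> cone_ideal W"
    using primeideal_prod[OF primeideal_cone_ideal[OF W(1)] finite_fermat_indices[OF n]]
    unfolding fermat_poly_eq_prod_plane_forms[OF prim] by blast
  obtain i j a where ija: "x = (i, j, a)"
    by (cases x)
  have "W \<subseteq> hyperplane i j a" "i \<noteq> j"
    using x index_pairs_neq by (auto simp: ija plane_form_in_cone_ideal fermat_indices_def)
  then have "W = hyperplane i j a"
    using W by (intro vec.subspace_dim_equal) (simp_all add: subspace_hyperplane dim_hyperplane)
  then show "H \<in> plane_of ` fermat_indices n"
    using x(1) W(3) by (auto simp: ija plane_of_def image_iff intro!: bexI[of _ x])
next
  fix H :: "'k point set" assume "H \<in> plane_of ` fermat_indices n"
  then show "H \<in> fermat_arrangement n"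
    using index_pairs_neq by (auto simp: plane_of_def fermat_indices_def intro!: hyperplane_in_arrangement)
qed

lemma finite_fermat_arrangement:
  assumes "primitive_root_of_unity n (\<epsilon> :: 'k::field_char_0)"
  shows "finite (fermat_arrangement n :: 'k point set set)"
proof -
  have "n > 0"
    using assms by (simp add: primitive_root_of_unity_def)
  then show ?thesis
    by (simp add: fermat_arrangement_eq[OF assms] finite_fermat_indices)
qed

definition multiple_lines :: "nat \<Rightarrow> 'k::field point set set"
  where "multiple_lines n = {V \<in> intersection_lattice (fermat_arrangement n).
    V \<in> lines \<and> multiplicity_along (fermat_arrangement n) V \<ge> 3}"

lemma restricted_fermat_ideal_eq:
  "restricted_fermat_ideal n = \<Inter>(vanishing_ideal ` multiple_lines n)"
  by (auto simp: restricted_fermat_ideal_def restricted_fermat_def multiple_lines_def vanishing_ideal_def)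

lemma finite_multiple_lines:
  assumes "primitive_root_of_unity n (\<epsilon> :: 'k::field_char_0)"
  shows "finite (multiple_lines n :: 'k point set set)"
proof (rule finite_subset)
  show "(multiple_lines n :: 'k point set set) \<subseteq> Inter ` Pow (fermat_arrangement n)"
    by (auto simp: multiple_lines_def intersection_lattice_def)
qed (simp add: finite_fermat_arrangement[OF assms])

lemma multiple_lineE:
  fixes V :: "'k::field_char_0 point set"
  assumes "V \<in> multiple_lines n"
  obtains W where "vec.subspace W" "vec.dim W = 2" "V = projectivization W"
    "vanishing_ideal V = cone_ideal W"
proof -
  obtain W where W: "vec.subspace W" "vec.dim W = 2" "V = projectivization W"
    using assms by (auto simp: multiple_lines_def linear_subspaces_def)
  then show ?thesis
    using that vanishing_ideal_projectivization[of W] by simp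
qed

text \<open>
  Exhibiting a line as the intersection of at least three distinct planes of the arrangement shows
  at once that it belongs to the intersection lattice and that its multiplicity is at least 3.
\<close>

lemma multiple_line_of_hyperplanes:
  fixes W :: "('k::field_char_0^4) set"
  assumes prim: "primitive_root_of_unity n (\<epsilon> :: 'k)"
    and W: "vec.subspace W" "vec.dim W = 2"
    and H: "\<H> = hyps ` J" "card \<H> \<ge> 3" "\<Inter>\<H> = W"
    and hyps: "\<And>x. x \<in> J \<Longrightarrow> \<exists>i j a. i \<noteq> j \<and> a \<in> roots_of_unity n \<and> hyps x = hyperplane i j a"
  shows "projectivization W \<in> multiple_lines n"
proof -
  have sub: "vec.subspace U" if U: "U \<in> \<H>" for U
  proof -
    obtain x where "x \<in> J" "U = hyps x"
      using U unfolding H(1) by blast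
    then show ?thesis
      using hyps[of x] subspace_hyperplane by auto
  qed
  have arr: "projectivization ` \<H> \<subseteq> fermat_arrangement n"
  proof -
    have "projectivization (hyps x) \<in> fermat_arrangement n" if "x \<in> J" for x
      using hyps[OF that] hyperplane_in_arrangement by auto
    then show ?thesis
      unfolding H(1) by blast
  qed
  have inj: "inj_on projectivization \<H>"
  proof (rule inj_onI)
    fix U U' assume "U \<in> \<H>" "U' \<in> \<H>" "projectivization U = projectivization U'"
    then show "U = U'"
      using projectivization_subset_iff[of U U'] projectivization_subset_iff[of U' U] sub by blast
  qed
  have "\<H> \<noteq> {}"
    using H(2) by auto
  then have V: "projectivization W = \<Inter>(projectivization ` \<H>)"
    using projectivization_Inter[of \<H>] sub H(3) by simp
  have "W \<noteq> {0}"
    using W(2) by auto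
  then obtain w where "w \<in> W - {0}"
    using vec.subspace_0[OF W(1)] by blast
  then have "projectivization W \<noteq> {}"
    by (auto simp: projectivization_def quotient_def)
  then have "projectivization W \<in> intersection_lattice (fermat_arrangement n)"
    using arr \<open>\<H> \<noteq> {}\<close> unfolding intersection_lattice_def V by blast
  moreover have "projectivization W \<in> lines"
    using W by (auto simp: linear_subspaces_def)
  moreover have "card \<H> \<le> multiplicity_along (fermat_arrangement n) (projectivization W)"
    unfolding multiplicity_along_def card_image[OF inj, symmetric]
    by (rule card_mono) (use arr V finite_fermat_arrangement[OF prim] in auto)
  ultimately show ?thesis
    using H(2) by (simp add: multiple_lines_def)
qed

lemma codim2_in_multiple_lines:
  fixes a b :: "'k::field_char_0"
  assumes prim: "primitive_root_of_unity n (\<epsilon> :: 'k)" and dist: "distinct [i, j, k]"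
    and ab: "a \<in> roots_of_unity n" "b \<in> roots_of_unity n"
  shows "projectivization (codim2 i j k a b) \<in> multiple_lines n"
proof -
  define J where "J = {(i, k, a), (j, k, b), (i, j, a / b)}"
  define hyps where "hyps = (\<lambda>(i, j, a). hyperplane i j a :: ('k^4) set)"
  have n: "n > 0"
    using prim by (simp add: primitive_root_of_unity_def)
  have "b \<noteq> 0"
    using ab n by (auto simp: roots_of_unity_def power_0_left)
  have "a / b \<in> roots_of_unity n"
    using ab by (simp add: roots_of_unity_def power_divide)
  \<comment> \<open>The three planes are told apart by the coordinate vectors that they contain.\<close>
  have axis: "axis j 1 \<in> hyperplane i k a" "axis j 1 \<notin> hyperplane j k b"
    "axis i 1 \<in> hyperplane j k b" "axis i 1 \<notin> hyperplane i j (a / b)" "axis i 1 \<notin> hyperplane i k a"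
    "axis k 1 \<in> hyperplane i j (a / b)" "axis k 1 \<notin> hyperplane i k a"
    using dist ab n by (auto simp: hyperplane_def axis_def roots_of_unity_def power_0_left)
  show ?thesis
  proof (rule multiple_line_of_hyperplanes[OF prim subspace_codim2 dim_codim2[OF dist] refl])
    have "hyps ` J = {hyperplane i k a, hyperplane j k b, hyperplane i j (a / b)}"
      by (simp add: hyps_def J_def)
    moreover have "hyperplane i k a \<noteq> hyperplane j k b" "hyperplane i k a \<noteq> hyperplane i j (a / b)"
      "hyperplane j k b \<noteq> hyperplane i j (a / b)"
      using axis by metis+
    ultimately show "3 \<le> card (hyps ` J)"
      by simp
    show "\<Inter>(hyps ` J) = codim2 i j k a b"
      using \<open>b \<noteq> 0\<close> by (auto simp: hyps_def J_def hyperplane_def codim2_def)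
    fix x assume "x \<in> J"
    then show "\<exists>i j a. i \<noteq> j \<and> a \<in> roots_of_unity n \<and> hyps x = hyperplane i j a"
      using dist ab \<open>a / b \<in> roots_of_unity n\<close> by (auto simp: J_def hyps_def)
  qed
qed

lemma coordinate_line_in_multiple_lines:
  assumes prim: "primitive_root_of_unity n (\<epsilon> :: 'k::field_char_0)" and "n \<ge> 3"
    and dist: "distinct [i, j, k]"
  shows "projectivization (codim2 i j k 0 (0 :: 'k)) \<in> multiple_lines n"
proof (rule multiple_line_of_hyperplanes[OF prim subspace_codim2 dim_codim2[OF dist] refl])
  let ?U = "roots_of_unity n :: 'k set"
  let ?h = "\<lambda>a :: 'k. hyperplane i j a"
  have "inj_on ?h ?U"
  proof (rule inj_onI)
    fix a b assume eq: "?h a = ?h b"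
    have "(\<chi> m. if m = i then a else 1) \<in> ?h a"
      using dist by (auto simp: hyperplane_def)
    then show "a = b"
      unfolding eq using dist by (auto simp: hyperplane_def)
  qed
  then show "3 \<le> card (?h ` ?U)"
    using card_roots_of_unity[OF prim] \<open>n \<ge> 3\<close> by (simp add: card_image)
  have U: "1 \<in> ?U" "\<epsilon> \<in> ?U" "\<epsilon> \<noteq> 1"
    using prim \<open>n \<ge> 3\<close> by (auto simp: primitive_root_of_unity_def roots_of_unity_def dest: spec[of _ 1])
  show "\<Inter>(?h ` ?U) = codim2 i j k 0 0"
  proof (intro equalityI subsetI)
    fix v assume "v \<in> \<Inter>(?h ` ?U)"
    then have "v \<in> ?h 1" "v \<in> ?h \<epsilon>"
      using U by blast+
    then have "v $ i = v $ j" "v $ i = \<epsilon> * v $ j"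
      by (simp_all add: hyperplane_def)
    then show "v \<in> codim2 i j k 0 0"
      using U(3) by (auto simp: codim2_def)
  qed (auto simp: codim2_def hyperplane_def)
  show "\<exists>i j a. i \<noteq> j \<and> a \<in> roots_of_unity n \<and> ?h x = hyperplane i j a" if "x \<in> ?U" for x
    using that dist by auto
qed

lemma restricted_fermat_ideal_subset_line_conditions:
  assumes prim: "primitive_root_of_unity n (\<epsilon> :: 'k::field_char_0)" and "n \<ge> 3"
  shows "(restricted_fermat_ideal n :: 'k poly4 set) \<subseteq> line_conditions n"
proof
  fix f :: "'k poly4" assume f: "f \<in> restricted_fermat_ideal n"
  have "f \<in> cone_ideal (codim2 i j k a b)"
    if "projectivization (codim2 i j k a b) \<in> multiple_lines n" "distinct [i, j, k]" for i j k a b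
    using f that vanishing_ideal_projectivization[OF subspace_codim2, of i j k a b] dim_codim2[OF that(2), of a b]
    by (auto simp: restricted_fermat_ideal_eq)
  then show "f \<in> line_conditions n"
    unfolding line_conditions_def
    using codim2_in_multiple_lines[OF prim] coordinate_line_in_multiple_lines[OF prim \<open>n \<ge> 3\<close>] by blast
qed

section \<open>The Fermat polynomial in the symbolic cube\<close>

lemma prod_in_ideal_power:
  assumes "finite J" "\<And>x. x \<in> J \<Longrightarrow> h x \<in> Q"
  shows "y * (\<Prod>x\<in>J. h x) \<in> ideal_power Q (card J)"
  using assms
proof (induction J rule: finite_induct)
  case (insert x J)
  have "(y * (\<Prod>x\<in>J. h x)) * h x \<in> ideal_power Q (Suc (card J))"
    using insert by (intro ideal_power_SucI) auto
  then show ?case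
    using insert.hyps by (simp add: algebra_simps)
qed simp

text \<open>
  At least three of the linear factors define planes that contain the line.
\<close>

lemma fermat_poly_in_line_ideal_cube:
  assumes prim: "primitive_root_of_unity n (\<epsilon> :: 'k::field_char_0)"
    and V: "(V :: 'k point set) \<in> multiple_lines n"
  shows "fermat_poly n \<in> ideal_power (vanishing_ideal V) 3"
proof -
  have n: "n > 0"
    using prim by (simp add: primitive_root_of_unity_def)
  note fin = finite_fermat_indices[OF n, where 'k = 'k]
  define J where "J = {x \<in> fermat_indices n :: (4 \<times> 4 \<times> 'k) set. V \<subseteq> plane_of x}"
  have "{H \<in> fermat_arrangement n. V \<subseteq> H} = plane_of ` J"
    by (auto simp: fermat_arrangement_eq[OF prim] J_def)
  then have "3 \<le> card (plane_of ` J)"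
    using V by (simp add: multiple_lines_def multiplicity_along_def)
  also have "\<dots> \<le> card J"
    using fin by (intro card_image_le) (simp add: J_def)
  finally obtain J' where J': "J' \<subseteq> J" "card J' = 3" "finite J'"
    by (rule obtain_subset_with_card_n)
  obtain W where W: "vec.subspace W" "V = projectivization W" "vanishing_ideal V = cone_ideal W"
    by (rule multiple_lineE[OF V])
  have "plane_form x \<in> vanishing_ideal V" if "x \<in> J'" for x
  proof -
    obtain i j a where x: "x = (i, j, a)"
      by (cases x)
    have "V \<subseteq> plane_of x"
      using that J' by (auto simp: J_def)
    then show ?thesis
      unfolding W(3) unfolding x plane_form_in_cone_ideal W(2)
      by (simp add: plane_of_def projectivization_subset_iff[OF W(1) subspace_hyperplane])
  qed
  then have "(\<Prod>x\<in>fermat_indices n - J'. plane_form x) * (\<Prod>x\<in>J'. plane_form x)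
      \<in> ideal_power (vanishing_ideal V) 3"
    unfolding J'(2)[symmetric] by (intro prod_in_ideal_power J'(3))
  moreover have "J' \<subseteq> fermat_indices n"
    using J'(1) by (auto simp: J_def)
  ultimately show ?thesis
    unfolding fermat_poly_eq_prod_plane_forms[OF prim]
    using fin by (simp add: prod.subset_diff[of J'])
qed

text \<open>
  A line in the intersection lattice is cut out by planes of the arrangement. If the linear forms of these
  planes vanish on the second line, it is contained in the first one.
\<close>

lemma multiple_line_ideals_incomparable:
  assumes prim: "primitive_root_of_unity n (\<epsilon> :: 'k::field_char_0)"
    and V: "(V :: 'k point set) \<in> multiple_lines n" "V' \<in> multiple_lines n"
    and sub: "vanishing_ideal V \<subseteq> vanishing_ideal V'"
  shows "V = V'"
proof -
  obtain W where W: "vec.subspace W" "vec.dim W = 2" "V = projectivization W" "vanishing_ideal V = cone_ideal W"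
    using multiple_lineE[OF V(1)] .
  obtain W' where W': "vec.subspace W'" "vec.dim W' = 2" "V' = projectivization W'" "vanishing_ideal V' = cone_ideal W'"
    using multiple_lineE[OF V(2)] .
  obtain \<B> where \<B>: "\<B> \<subseteq> fermat_arrangement n" "V = \<Inter>\<B>"
    using V(1) by (auto simp: multiple_lines_def intersection_lattice_def)
  have "V' \<subseteq> H" if HB: "H \<in> \<B>" for H
  proof -
    obtain x where "H = plane_of x"
      using HB \<B>(1) unfolding fermat_arrangement_eq[OF prim] by blast
    then obtain i j a where H: "H = projectivization (hyperplane i j a)"
      by (cases x) (simp add: plane_of_def)
    have "V \<subseteq> H"
      using HB \<B>(2) by blast
    then have "W \<subseteq> hyperplane i j a"
      by (simp add: H W(3) projectivization_subset_iff[OF W(1) subspace_hyperplane])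
    then have "plane_form (i, j, a) \<in> vanishing_ideal V"
      by (simp add: W(4) plane_form_in_cone_ideal)
    then have "plane_form (i, j, a) \<in> cone_ideal W'"
      using sub W'(4) by blast
    then show ?thesis
      unfolding plane_form_in_cone_ideal H W'(3)
      by (simp add: projectivization_subset_iff[OF W'(1) subspace_hyperplane])
  qed
  then have "V' \<subseteq> V"
    using \<B>(2) by blast
  then have "W' \<subseteq> W"
    by (simp add: W(3) W'(3) projectivization_subset_iff[OF W'(1) W(1)])
  then have "W' = W"
    using W W' by (intro vec.subspace_dim_equal) simp_all
  then show ?thesis
    by (simp add: W(3) W'(3))
qed

lemma fermat_poly_in_symbolic_cube:
  assumes prim: "primitive_root_of_unity n (\<epsilon> :: 'k::field_char_0)"
  shows "fermat_poly n \<in> symbolic_power (restricted_fermat_ideal n :: 'k poly4 set) 3"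
  unfolding restricted_fermat_ideal_eq
proof (rule symbolic_power_InterI)
  show "finite (vanishing_ideal ` (multiple_lines n :: 'k point set set))"
    by (intro finite_imageI finite_multiple_lines[OF prim])
next
  fix Q :: "'k poly4 set" assume "Q \<in> vanishing_ideal ` multiple_lines n"
  then obtain V where V: "V \<in> multiple_lines n" "Q = vanishing_ideal V"
    by blast
  obtain W where "vec.subspace W" "vanishing_ideal V = cone_ideal W"
    by (rule multiple_lineE[OF V(1)])
  then show "primeideal Q ring_of_type_algebra"
    using primeideal_cone_ideal V(2) by simp
  show "fermat_poly n \<in> ideal_power Q 3"
    using fermat_poly_in_line_ideal_cube[OF prim V(1)] V(2) by simp
next
  fix P Q :: "'k poly4 set"
  assume "P \<in> vanishing_ideal ` multiple_lines n" "Q \<in> vanishing_ideal ` multiple_lines n" "P \<subseteq> Q"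
  then show "P = Q"
    using multiple_line_ideals_incomparable[OF prim] by blast
qed

theorem theorem4p3:
  fixes n :: nat
  assumes "n \<ge> 3"
    and "\<exists>\<epsilon> :: 'k::field_char_0. primitive_root_of_unity n \<epsilon>"
  shows "\<not> symbolic_power (restricted_fermat_ideal n :: 'k poly4 set) 3
           \<subseteq> ideal_power (restricted_fermat_ideal n) 2"
proof
  assume sub: "symbolic_power (restricted_fermat_ideal n :: 'k poly4 set) 3
    \<subseteq> ideal_power (restricted_fermat_ideal n) 2"
  obtain \<epsilon> :: 'k where prim: "primitive_root_of_unity n \<epsilon>"
    using assms(2) by blast
  have "ideal (restricted_fermat_ideal n :: 'k poly4 set) ring_of_type_algebra"
    by (rule ideal_type_algebraI)
      (auto simp: restricted_fermat_ideal_def vanishing_ideal_def vanishes_at_def)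
  moreover have "fermat_poly n \<in> ideal_power (restricted_fermat_ideal n :: 'k poly4 set) 2"
    using fermat_poly_in_symbolic_cube[OF prim] sub by blast
  ultimately have "Poly_Mapping.lookup (fermat_poly n :: 'k poly4) (expo (2 * n) (3 * n) n 0) =
      Poly_Mapping.lookup (fermat_poly n :: 'k poly4) (expo (2 * n) n (3 * n) 0)"
    using ideal_square_coefficients_eq[OF prim
      restricted_fermat_ideal_subset_line_conditions[OF prim \<open>n \<ge> 3\<close>]] by blast
  then have "- 1 = (1 :: 'k)"
    using fermat_poly_coefficients[of n, where 'k = 'k] \<open>n \<ge> 3\<close> by simp
  then show False
    by simp
qed

end
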